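(* Fix a Borel probability measure $\mu$ on $\mathbb{R}$, and let $M_\mu$ be the operator of multiplication by $\lambda$ in $L^2(\mu)=L^2(\mathbb{R},\mu)$. There is a 1-1 bijective correspondence between the following: (1) closed subspaces $\mathscr{L}\subset L^2(\mu)$ such that (i) $\dim(\mathscr{L})=d<\infty$, and (ii) the following implication holds: if $g\neq0$ and $g\in\mathscr{L}$, then $[\lambda\mapsto\lambda g(\lambda)]\notin L^2(\mu)$; (2) Hermitian restrictions $S_{\mathscr{L}}$ of $M_\mu$ such that $DEF_+(S_{\mathscr{L}})=\mathscr{L}$. Given $\mathscr{L}$ as in (1), one sets $$\mathrm{dom}(S_{\mathscr{L}}):=\Big\{f\in\mathrm{dom}(M_\mu):\ \int_{\mathbb{R}}\overline{g(\lambda)}(\lambda+i)f(\lambda)\,d\mu(\lambda)=0\ \text{ for all } g\in\mathscr{L}\Big\},\qquad S_{\mathscr{L}}:=M_\mu|_{\mathrm{dom}(S_{\mathscr{L}})}.$$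
   Context: $\mathrm{dom}(M_\mu)=\{f\in L^2(\mu):\lambda f\in L^2(\mu)\}$ and $(M_\mu f)(\lambda)=\lambda f(\lambda)$. For a densely defined restriction $S$ of $M_\mu$ with adjoint $S^*$, the (+) deficiency space is $DEF_+(S)=\{g\in\mathrm{dom}(S^* ): S^*g=ig\}$, where $i=\sqrt{-1}$.
   Formalization: In (2) only closed Hermitian restrictions are counted, since a non-closed restriction has the same deficiency space as its closure; for any Hermitian restriction with finite-dimensional deficiency space L, it is also shown that L satisfies (1) and that its closure is S_L. *)

theory Defs
  imports "HOL-Probability.Probability"
begin

section \<open>The Hilbert space $L^2(\mu)$\<close>

text \<open>
  Vectors are equivalence classes of square-integrable complex functions modulo equality almost
  everywhere, so that equality of vectors, subspaces and operators below is equality in HOL.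
  Each operation picks representatives; on \<open>L2 \<mu>\<close> the result does not depend on the choice.
\<close>

definition sq_integrable :: "real measure \<Rightarrow> (real \<Rightarrow> complex) set" where
  "sq_integrable \<mu> = {f \<in> borel_measurable \<mu>. integrable \<mu> (\<lambda>x. (cmod (f x))\<^sup>2)}"

definition ae_eq :: "real measure \<Rightarrow> (real \<Rightarrow> complex) rel" where
  "ae_eq \<mu> = {(f, g). f \<in> sq_integrable \<mu> \<and> g \<in> sq_integrable \<mu> \<and> (AE x in \<mu>. f x = g x)}"

type_synonym l2vec = "(real \<Rightarrow> complex) set"

definition L2 :: "real measure \<Rightarrow> l2vec set" where
  "L2 \<mu> = sq_integrable \<mu> // ae_eq \<mu>"

definition cls :: "real measure \<Rightarrow> (real \<Rightarrow> complex) \<Rightarrow> l2vec" where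
  "cls \<mu> f = ae_eq \<mu> `` {f}"

definition rep :: "l2vec \<Rightarrow> real \<Rightarrow> complex" where
  "rep F = (SOME f. f \<in> F)"

definition l2_zero :: "real measure \<Rightarrow> l2vec" where
  "l2_zero \<mu> = cls \<mu> (\<lambda>x. 0)"

definition l2_add :: "real measure \<Rightarrow> l2vec \<Rightarrow> l2vec \<Rightarrow> l2vec" where
  "l2_add \<mu> F G = cls \<mu> (\<lambda>x. rep F x + rep G x)"

definition l2_scale :: "real measure \<Rightarrow> complex \<Rightarrow> l2vec \<Rightarrow> l2vec" where
  "l2_scale \<mu> c F = cls \<mu> (\<lambda>x. c * rep F x)"

definition l2_inner :: "real measure \<Rightarrow> l2vec \<Rightarrow> l2vec \<Rightarrow> complex" where
  "l2_inner \<mu> F G = (LINT x|\<mu>. cnj (rep F x) * rep G x)"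

definition l2_dist :: "real measure \<Rightarrow> l2vec \<Rightarrow> l2vec \<Rightarrow> real" where
  "l2_dist \<mu> F G = sqrt (LINT x|\<mu>. (cmod (rep F x - rep G x))\<^sup>2)"

definition l2_topology :: "real measure \<Rightarrow> l2vec topology" where
  "l2_topology \<mu> = Metric_space.mtopology (L2 \<mu>) (l2_dist \<mu>)"

definition l2_subspace :: "real measure \<Rightarrow> l2vec set \<Rightarrow> bool" where
  "l2_subspace \<mu> V \<longleftrightarrow> V \<subseteq> L2 \<mu> \<and> l2_zero \<mu> \<in> V \<and>
     (\<forall>F\<in>V. \<forall>G\<in>V. l2_add \<mu> F G \<in> V) \<and> (\<forall>c. \<forall>F\<in>V. l2_scale \<mu> c F \<in> V)"

definition l2_lincomb :: "real measure \<Rightarrow> (l2vec \<Rightarrow> complex) \<Rightarrow> l2vec set \<Rightarrow> l2vec" where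
  "l2_lincomb \<mu> c B = cls \<mu> (\<lambda>x. \<Sum>F\<in>B. c F * rep F x)"

definition finite_dimensional :: "real measure \<Rightarrow> l2vec set \<Rightarrow> bool" where
  "finite_dimensional \<mu> V \<longleftrightarrow> (\<exists>B. finite B \<and> B \<subseteq> V \<and> V = range (\<lambda>c. l2_lincomb \<mu> c B))"


section \<open>Unbounded operators\<close>

text \<open>An operator is represented by its graph; its domain is \<^const>\<open>Domain\<close>.\<close>

type_synonym l2op = "l2vec rel"

definition linear_operator :: "real measure \<Rightarrow> l2op \<Rightarrow> bool" where
  "linear_operator \<mu> T \<longleftrightarrow> T \<subseteq> L2 \<mu> \<times> L2 \<mu> \<and> single_valued T \<and> (l2_zero \<mu>, l2_zero \<mu>) \<in> T \<and>
     (\<forall>(F, G)\<in>T. \<forall>(F', G')\<in>T. (l2_add \<mu> F F', l2_add \<mu> G G') \<in> T) \<and>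
     (\<forall>c. \<forall>(F, G)\<in>T. (l2_scale \<mu> c F, l2_scale \<mu> c G) \<in> T)"

definition densely_defined :: "real measure \<Rightarrow> l2op \<Rightarrow> bool" where
  "densely_defined \<mu> T \<longleftrightarrow> l2_topology \<mu> closure_of Domain T = L2 \<mu>"

definition graph_topology :: "real measure \<Rightarrow> (l2vec \<times> l2vec) topology" where
  "graph_topology \<mu> = prod_topology (l2_topology \<mu>) (l2_topology \<mu>)"

definition closed_operator :: "real measure \<Rightarrow> l2op \<Rightarrow> bool" where
  "closed_operator \<mu> T \<longleftrightarrow> linear_operator \<mu> T \<and> closedin (graph_topology \<mu>) T"

text \<open>The relation below is the graph of an operator exactly when \<open>T\<close> is densely defined.\<close>

definition adjoint_op :: "real measure \<Rightarrow> l2op \<Rightarrow> l2op" where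
  "adjoint_op \<mu> T =
     {(G, H). G \<in> L2 \<mu> \<and> H \<in> L2 \<mu> \<and> (\<forall>(F, K)\<in>T. l2_inner \<mu> G K = l2_inner \<mu> H F)}"

definition hermitian_operator :: "real measure \<Rightarrow> l2op \<Rightarrow> bool" where
  "hermitian_operator \<mu> T \<longleftrightarrow>
     linear_operator \<mu> T \<and> densely_defined \<mu> T \<and> T \<subseteq> adjoint_op \<mu> T"

definition DEF_plus :: "real measure \<Rightarrow> l2op \<Rightarrow> l2vec set" where
  "DEF_plus \<mu> S = {G \<in> Domain (adjoint_op \<mu> S). (G, l2_scale \<mu> \<i> G) \<in> adjoint_op \<mu> S}"


section \<open>Multiplication by the variable and its restrictions\<close>

definition mult_op :: "real measure \<Rightarrow> l2op" where
  "mult_op \<mu> = {(cls \<mu> f, cls \<mu> (\<lambda>x. of_real x * f x)) | f.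
     f \<in> sq_integrable \<mu> \<and> (\<lambda>x. of_real x * f x) \<in> sq_integrable \<mu>}"

definition hermitian_restriction :: "real measure \<Rightarrow> l2op \<Rightarrow> bool" where
  "hermitian_restriction \<mu> S \<longleftrightarrow> hermitian_operator \<mu> S \<and> S \<subseteq> mult_op \<mu>"

definition admissible_subspaces :: "real measure \<Rightarrow> l2vec set set" where
  "admissible_subspaces \<mu> = {V. l2_subspace \<mu> V \<and> closedin (l2_topology \<mu>) V \<and>
     finite_dimensional \<mu> V \<and>
     (\<forall>G\<in>V. G \<noteq> l2_zero \<mu> \<longrightarrow> (\<lambda>x. of_real x * rep G x) \<notin> sq_integrable \<mu>)}"

definition restr_op :: "real measure \<Rightarrow> l2vec set \<Rightarrow> l2op" where
  "restr_op \<mu> V = {(F, K) \<in> mult_op \<mu>.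
     \<forall>G\<in>V. (LINT x|\<mu>. cnj (rep G x) * (of_real x + \<i>) * rep F x) = 0}"

end

theory Submission
  imports Defs
begin

text \<open>
  Write \<open>M\<close> for the operator of multiplication by the variable. The function \<open>x + \<i>\<close> is bounded away
  from zero, so \<open>M + \<i>\<close> is a bijection from the domain of \<open>M\<close> onto \<open>L\<^sup>2(\<mu>)\<close>, and convergence in its
  range is the same as convergence in the graph of \<open>M\<close> (\<open>shifted_mult_op_surj\<close>,
  \<open>shifted_mult_op_expanding\<close>). A linear restriction \<open>S\<close> of \<open>M\<close> is thus the same thing as the subspace
  \<open>R = (S + \<i>) dom S\<close>, with closed operators corresponding to closed subspaces.

  In these terms everything is orthogonal complementation. The deficiency space of \<open>S\<close> is
  \<open>R\<^sup>\<bottom>\<close> (\<open>DEF_plus_eq_orth\<close>), and the restriction determined by a subspace \<open>V\<close> is the one with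
  \<open>R = V\<^sup>\<bottom>\<close> (\<open>shifted_restr_op\<close>). The bipolar theorem \<open>W\<^sup>\<bottom>\<^sup>\<bottom> = closure W\<close>
  (\<open>orth_orth_eq_closure\<close>) then shows that the two passages are inverse to each other up to closure.

  The condition that no nonzero \<open>G\<close> in \<open>V\<close> has \<open>x G\<close> in \<open>L\<^sup>2(\<mu>)\<close> is exactly density of the domain:
  the vectors orthogonal to the domain are the \<open>(x - \<i>) G\<close> in \<open>L\<^sup>2(\<mu>)\<close> with \<open>G\<close> in \<open>V\<close>
  (\<open>densely_defined_restr_op\<close>, \<open>DEF_plus_admissible\<close>). The bipolar theorem rests on the projection
  onto a closed subspace, hence on completeness of \<open>L\<^sup>2(\<mu>)\<close>, which is proved as \<open>Riesz_Fischer\<close>.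
\<close>


section \<open>The geometry of square-integrable functions\<close>

text \<open>
  The form \<open>ip\<close> and the seminorm \<open>nrm\<close> act on functions rather than on classes. Identities between
  functions hold pointwise, so working with them first avoids choosing representatives in every
  algebraic step.
\<close>

definition ip :: "real measure \<Rightarrow> (real \<Rightarrow> complex) \<Rightarrow> (real \<Rightarrow> complex) \<Rightarrow> complex" where
  "ip \<mu> f g = (LINT x|\<mu>. cnj (f x) * g x)"

definition nrm :: "real measure \<Rightarrow> (real \<Rightarrow> complex) \<Rightarrow> real" where
  "nrm \<mu> f = sqrt (LINT x|\<mu>. (cmod (f x))\<^sup>2)"

lemma sq_integrable_measurable [measurable_dest]:
  "f \<in> sq_integrable \<mu> \<Longrightarrow> f \<in> borel_measurable \<mu>"
  by (simp add: sq_integrable_def)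

lemma sq_integrable_zero: "(\<lambda>x. 0) \<in> sq_integrable \<mu>"
  by (simp add: sq_integrable_def)

lemma sq_integrable_add:
  assumes "f \<in> sq_integrable \<mu>" "g \<in> sq_integrable \<mu>"
  shows "(\<lambda>x. f x + g x) \<in> sq_integrable \<mu>"
proof -
  have [measurable]: "f \<in> borel_measurable \<mu>" "g \<in> borel_measurable \<mu>"
    using assms by (auto simp: sq_integrable_def)
  have "(cmod (a + b))\<^sup>2 \<le> 2 * (cmod a)\<^sup>2 + 2 * (cmod b)\<^sup>2" for a b
  proof -
    have "(cmod (a + b))\<^sup>2 \<le> (cmod a + cmod b)\<^sup>2"
      by (intro power_mono norm_triangle_ineq norm_ge_zero)
    also have "\<dots> \<le> 2 * (cmod a)\<^sup>2 + 2 * (cmod b)\<^sup>2"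
      using sum_squares_bound[of "cmod a" "cmod b"] by (simp add: power2_sum)
    finally show ?thesis .
  qed
  then have bound: "AE x in \<mu>. norm ((cmod (f x + g x))\<^sup>2)
      \<le> norm (2 * (cmod (f x))\<^sup>2 + 2 * (cmod (g x))\<^sup>2)"
    by simp
  have "integrable \<mu> (\<lambda>x. (cmod (f x + g x))\<^sup>2)"
    by (rule Bochner_Integration.integrable_bound[OF _ _ bound])
       (use assms in \<open>auto simp: sq_integrable_def\<close>)
  then show ?thesis
    by (simp add: sq_integrable_def)
qed

text \<open>
  This puts \<open>f(x) / (x + \<i>)\<close> and \<open>x f(x) / (x + \<i>)\<close> into \<open>L\<^sup>2\<close>, so the resolvent of the
  multiplication operator maps \<open>L\<^sup>2\<close> into the domain.
\<close>

lemma sq_integrable_bounded_mult: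
  assumes "f \<in> sq_integrable \<mu>" and h: "h \<in> borel_measurable \<mu>" and "\<And>x. cmod (h x) \<le> C"
  shows "(\<lambda>x. h x * f x) \<in> sq_integrable \<mu>"
proof -
  have [measurable]: "f \<in> borel_measurable \<mu>" "h \<in> borel_measurable \<mu>"
    using assms by (auto simp: sq_integrable_def)
  have "(cmod (h x * f x))\<^sup>2 \<le> C\<^sup>2 * (cmod (f x))\<^sup>2" for x
    using assms(3)[of x] by (simp add: norm_mult power_mult_distrib power_mono mult_right_mono)
  then have bound: "AE x in \<mu>. norm ((cmod (h x * f x))\<^sup>2) \<le> norm (C\<^sup>2 * (cmod (f x))\<^sup>2)"
    by simp
  have "integrable \<mu> (\<lambda>x. (cmod (h x * f x))\<^sup>2)"
    by (rule Bochner_Integration.integrable_bound[OF _ _ bound])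
       (use assms(1) in \<open>auto simp: sq_integrable_def\<close>)
  then show ?thesis
    by (simp add: sq_integrable_def)
qed

lemma sq_integrable_scale:
  "f \<in> sq_integrable \<mu> \<Longrightarrow> (\<lambda>x. c * f x) \<in> sq_integrable \<mu>"
  by (rule sq_integrable_bounded_mult[where C = "cmod c"]) auto

lemma sq_integrable_diff:
  assumes "f \<in> sq_integrable \<mu>" "g \<in> sq_integrable \<mu>"
  shows "(\<lambda>x. f x - g x) \<in> sq_integrable \<mu>"
  using sq_integrable_add[OF assms(1) sq_integrable_scale[OF assms(2), of "-1"]] by simp

lemma sq_integrable_cong_AE:
  assumes "f \<in> sq_integrable \<mu>" "g \<in> borel_measurable \<mu>" "AE x in \<mu>. f x = g x"
  shows "g \<in> sq_integrable \<mu>"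
proof -
  have "integrable \<mu> (\<lambda>x. (cmod (f x))\<^sup>2) \<longleftrightarrow> integrable \<mu> (\<lambda>x. (cmod (g x))\<^sup>2)"
    by (rule integrable_cong_AE) (use assms in \<open>auto simp: sq_integrable_def\<close>)
  then show ?thesis
    using assms by (simp add: sq_integrable_def)
qed

lemmas sq_integrable_intros =
  sq_integrable_zero sq_integrable_add sq_integrable_scale sq_integrable_diff

lemma borel_measurable_cnj [measurable]: "cnj \<in> borel_measurable borel"
  by (intro borel_measurable_continuous_onI continuous_intros)

lemma integrable_cnj_mult:
  assumes "f \<in> sq_integrable \<mu>" "g \<in> sq_integrable \<mu>"
  shows "integrable \<mu> (\<lambda>x. cnj (f x) * g x)"
proof (rule Bochner_Integration.integrable_bound)
  show "integrable \<mu> (\<lambda>x. (cmod (f x))\<^sup>2 + (cmod (g x))\<^sup>2)"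
    using assms by (auto simp: sq_integrable_def)
  show "(\<lambda>x. cnj (f x) * g x) \<in> borel_measurable \<mu>"
    using assms by (auto simp: sq_integrable_def)
  have "cmod a * cmod b \<le> (cmod a)\<^sup>2 + (cmod b)\<^sup>2" for a b
    using sum_squares_bound[of "cmod a" "cmod b"]
      mult_nonneg_nonneg[OF norm_ge_zero norm_ge_zero, of a b] by linarith
  then show "AE x in \<mu>. norm (cnj (f x) * g x) \<le> norm ((cmod (f x))\<^sup>2 + (cmod (g x))\<^sup>2)"
    by (simp add: norm_mult)
qed

lemma ip_cong_AE:
  assumes "f \<in> borel_measurable \<mu>" "f' \<in> borel_measurable \<mu>"
    and "g \<in> borel_measurable \<mu>" "g' \<in> borel_measurable \<mu>"
    and "AE x in \<mu>. f x = f' x" "AE x in \<mu>. g x = g' x"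
  shows "ip \<mu> f g = ip \<mu> f' g'"
  unfolding ip_def using assms by (intro integral_cong_AE) auto

lemma ip_commute: "ip \<mu> g f = cnj (ip \<mu> f g)"
  unfolding ip_def
  by (subst Bochner_Integration.integral_cnj [symmetric]) (simp add: mult.commute)

lemma ip_scale_right: "ip \<mu> f (\<lambda>x. c * g x) = c * ip \<mu> f g"
  unfolding ip_def by (simp add: mult.left_commute)

lemma ip_add_right:
  assumes "f \<in> sq_integrable \<mu>" "g \<in> sq_integrable \<mu>" "h \<in> sq_integrable \<mu>"
  shows "ip \<mu> f (\<lambda>x. g x + h x) = ip \<mu> f g + ip \<mu> f h"
  unfolding ip_def using assms by (simp add: ring_distribs integrable_cnj_mult)

lemma ip_diff_right:
  assumes "f \<in> sq_integrable \<mu>" "g \<in> sq_integrable \<mu>" "h \<in> sq_integrable \<mu>"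
  shows "ip \<mu> f (\<lambda>x. g x - h x) = ip \<mu> f g - ip \<mu> f h"
  unfolding ip_def using assms by (simp add: ring_distribs integrable_cnj_mult)

lemma nrm_nonneg [simp]: "0 \<le> nrm \<mu> f"
  by (simp add: nrm_def)

lemma nrm_sq: "(nrm \<mu> f)\<^sup>2 = (LINT x|\<mu>. (cmod (f x))\<^sup>2)"
  by (simp add: nrm_def)

lemma ip_self: "ip \<mu> f f = of_real ((nrm \<mu> f)\<^sup>2)"
  unfolding ip_def nrm_sq integral_complex_of_real[symmetric]
  by (intro arg_cong[where f = "integral\<^sup>L \<mu>"] ext)
     (metis complex_norm_square mult.commute)

lemma nrm_sq_nn_integral:
  "f \<in> sq_integrable \<mu> \<Longrightarrow> (\<integral>\<^sup>+x. ennreal ((cmod (f x))\<^sup>2) \<partial>\<mu>) = ennreal ((nrm \<mu> f)\<^sup>2)"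
  unfolding nrm_sq by (rule nn_integral_eq_integral) (auto simp: sq_integrable_def)

lemma nrm_eq_0_iff:
  assumes "f \<in> sq_integrable \<mu>"
  shows "nrm \<mu> f = 0 \<longleftrightarrow> (AE x in \<mu>. f x = 0)"
  using assms by (simp add: nrm_def sq_integrable_def integral_nonneg_eq_0_iff_AE)

lemma nrm_cong_AE:
  assumes "f \<in> borel_measurable \<mu>" "g \<in> borel_measurable \<mu>" "AE x in \<mu>. f x = g x"
  shows "nrm \<mu> f = nrm \<mu> g"
  unfolding nrm_def using assms by (intro arg_cong[where f = sqrt] integral_cong_AE) auto

lemma nrm_scale: "nrm \<mu> (\<lambda>x. c * f x) = cmod c * nrm \<mu> f"
  by (simp add: nrm_def norm_mult power_mult_distrib real_sqrt_mult)

lemma nrm_minus_commute: "nrm \<mu> (\<lambda>x. f x - g x) = nrm \<mu> (\<lambda>x. g x - f x)"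
  by (simp add: nrm_def norm_minus_commute)

lemma nrm_mono:
  assumes "f \<in> sq_integrable \<mu>" "g \<in> sq_integrable \<mu>" "\<And>x. cmod (f x) \<le> cmod (g x)"
  shows "nrm \<mu> f \<le> nrm \<mu> g"
  unfolding nrm_def using assms
  by (intro real_sqrt_le_mono integral_mono) (auto simp: sq_integrable_def power_mono)

lemma integral_norm_mult_le_nrm:
  assumes "f \<in> sq_integrable \<mu>" "g \<in> sq_integrable \<mu>"
  shows "(LINT x|\<mu>. cmod (f x) * cmod (g x)) \<le> nrm \<mu> f * nrm \<mu> g"
proof -
  have [measurable]: "f \<in> borel_measurable \<mu>" "g \<in> borel_measurable \<mu>"
    using assms by (auto simp: sq_integrable_def)
  have int: "integrable \<mu> (\<lambda>x. cmod (f x) * cmod (g x))"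
    using integrable_norm[OF integrable_cnj_mult[OF assms]] by (simp add: norm_mult)
  let ?I = "LINT x|\<mu>. cmod (f x) * cmod (g x)"
  have nonneg: "?I \<ge> 0"
    by (intro integral_nonneg_AE) auto
  have "ennreal (?I\<^sup>2) = (\<integral>\<^sup>+x. ennreal (cmod (f x)) * ennreal (cmod (g x)) \<partial>\<mu>)\<^sup>2"
    using nn_integral_eq_integral[OF int] nonneg by (simp add: ennreal_mult ennreal_power)
  also have "\<dots> \<le> (\<integral>\<^sup>+x. (ennreal (cmod (f x)))\<^sup>2 \<partial>\<mu>) * (\<integral>\<^sup>+x. (ennreal (cmod (g x)))\<^sup>2 \<partial>\<mu>)"
    by (rule Cauchy_Schwarz_nn_integral) auto
  also have "\<dots> = ennreal ((nrm \<mu> f * nrm \<mu> g)\<^sup>2)"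
    using nrm_sq_nn_integral[OF assms(1)] nrm_sq_nn_integral[OF assms(2)]
    by (simp add: ennreal_power ennreal_mult power_mult_distrib)
  finally have "?I\<^sup>2 \<le> (nrm \<mu> f * nrm \<mu> g)\<^sup>2"
    by simp
  then show ?thesis
    by (rule power2_le_imp_le) simp
qed

lemma Cauchy_Schwarz_ip:
  assumes "f \<in> sq_integrable \<mu>" "g \<in> sq_integrable \<mu>"
  shows "cmod (ip \<mu> f g) \<le> nrm \<mu> f * nrm \<mu> g"
proof -
  have "cmod (ip \<mu> f g) \<le> (LINT x|\<mu>. cmod (cnj (f x) * g x))"
    unfolding ip_def by (rule integral_norm_bound)
  also have "\<dots> \<le> nrm \<mu> f * nrm \<mu> g"
    using integral_norm_mult_le_nrm[OF assms] by (simp add: norm_mult)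
  finally show ?thesis .
qed

lemma nrm_sq_add:
  assumes "f \<in> sq_integrable \<mu>" "g \<in> sq_integrable \<mu>"
  shows "(nrm \<mu> (\<lambda>x. f x + g x))\<^sup>2 = (nrm \<mu> f)\<^sup>2 + (nrm \<mu> g)\<^sup>2 + 2 * Re (ip \<mu> f g)"
proof -
  define h where "h x = cnj (f x) * g x" for x
  have int: "integrable \<mu> h" "integrable \<mu> (\<lambda>x. (cmod (f x))\<^sup>2)" "integrable \<mu> (\<lambda>x. (cmod (g x))\<^sup>2)"
    using assms integrable_cnj_mult[OF assms] by (auto simp: h_def[abs_def] sq_integrable_def)
  have "(cmod (f x + g x))\<^sup>2 = (cmod (f x))\<^sup>2 + (cmod (g x))\<^sup>2 + 2 * Re (h x)" for x
    unfolding cmod_power2 h_def by (simp add: power2_eq_square algebra_simps)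
  then have "(nrm \<mu> (\<lambda>x. f x + g x))\<^sup>2
      = (LINT x|\<mu>. (cmod (f x))\<^sup>2 + (cmod (g x))\<^sup>2 + 2 * Re (h x))"
    by (simp add: nrm_sq)
  also have "\<dots> = (nrm \<mu> f)\<^sup>2 + (nrm \<mu> g)\<^sup>2 + 2 * Re (integral\<^sup>L \<mu> h)"
    using int by (simp add: nrm_sq integral_Re)
  finally show ?thesis
    by (simp add: ip_def h_def[abs_def])
qed

lemma nrm_triangle:
  assumes "f \<in> sq_integrable \<mu>" "g \<in> sq_integrable \<mu>"
  shows "nrm \<mu> (\<lambda>x. f x + g x) \<le> nrm \<mu> f + nrm \<mu> g"
proof (rule power2_le_imp_le)
  have "Re (ip \<mu> f g) \<le> nrm \<mu> f * nrm \<mu> g"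
    using Cauchy_Schwarz_ip[OF assms] complex_Re_le_cmod order_trans by blast
  then show "(nrm \<mu> (\<lambda>x. f x + g x))\<^sup>2 \<le> (nrm \<mu> f + nrm \<mu> g)\<^sup>2"
    unfolding nrm_sq_add[OF assms] by (simp add: power2_sum)
qed simp

lemma nrm_triangle_diff:
  assumes "f \<in> sq_integrable \<mu>" "g \<in> sq_integrable \<mu>" "h \<in> sq_integrable \<mu>"
  shows "nrm \<mu> (\<lambda>x. f x - h x) \<le> nrm \<mu> (\<lambda>x. f x - g x) + nrm \<mu> (\<lambda>x. g x - h x)"
  using nrm_triangle[OF sq_integrable_diff[OF assms(1,2)] sq_integrable_diff[OF assms(2,3)]]
  by simp

lemma nrm_parallelogram:
  assumes "f \<in> sq_integrable \<mu>" "g \<in> sq_integrable \<mu>"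
  shows "(nrm \<mu> (\<lambda>x. f x + g x))\<^sup>2 + (nrm \<mu> (\<lambda>x. f x - g x))\<^sup>2
       = 2 * (nrm \<mu> f)\<^sup>2 + 2 * (nrm \<mu> g)\<^sup>2"
  using nrm_sq_add[OF assms] nrm_sq_add[OF assms(1) sq_integrable_scale[OF assms(2), of "-1"]]
    nrm_scale[of \<mu> "-1" g] ip_scale_right[of \<mu> f "-1" g]
  by simp

text \<open>
  Completeness of \<open>L\<^sup>2\<close>. Over a probability measure the \<open>L\<^sup>2\<close>-norm dominates the \<open>L\<^sup>1\<close>-norm, so an
  \<open>L\<^sup>2\<close>-Cauchy sequence is \<open>L\<^sup>1\<close>-Cauchy and has an almost everywhere convergent subsequence. Fatou's
  lemma turns its pointwise limit into a limit in \<open>L\<^sup>2\<close>.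
\<close>

lemma Riesz_Fischer:
  assumes "prob_space \<mu>"
    and f: "\<And>n. f n \<in> sq_integrable \<mu>"
    and cauchy: "\<And>e. e > 0 \<Longrightarrow> \<exists>N. \<forall>m\<ge>N. \<forall>n\<ge>N. nrm \<mu> (\<lambda>x. f m x - f n x) < e"
  obtains g where "g \<in> sq_integrable \<mu>" "(\<lambda>n. nrm \<mu> (\<lambda>x. g x - f n x)) \<longlonglongrightarrow> 0"
proof -
  interpret prob_space \<mu> by fact
  have [measurable]: "f n \<in> borel_measurable \<mu>" for n
    using f by (simp add: sq_integrable_def)
  have one: "(\<lambda>x. 1) \<in> sq_integrable \<mu>" "nrm \<mu> (\<lambda>x. 1) = 1"
    by (auto simp: sq_integrable_def nrm_def prob_space)
  have L1: "(LINT x|\<mu>. cmod (h x)) \<le> nrm \<mu> h" if "h \<in> sq_integrable \<mu>" for h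
    using integral_norm_mult_le_nrm[OF that one(1)] one(2) by simp
  have int: "integrable \<mu> (f n)" for n
    using integrable_cnj_mult[OF one(1) f] by simp
  obtain r where r: "strict_mono r" and "AE x in \<mu>. Cauchy (\<lambda>i. f (r i) x)"
  proof (rule cauchy_L1_AE_cauchy_subseq[OF int])
    show "\<exists>N. \<forall>i\<ge>N. \<forall>j\<ge>N. (LINT x|\<mu>. cmod (f i x - f j x)) < e" if "e > 0" for e
      using cauchy[OF that] L1[OF sq_integrable_diff[OF f f]] by (meson order_le_less_trans)
  qed
  then have conv: "AE x in \<mu>. convergent (\<lambda>i. f (r i) x)"
    by (simp add: Cauchy_convergent_iff)
  define g where "g x = lim (\<lambda>i. f (r i) x)" for x
  have [measurable]: "g \<in> borel_measurable \<mu>"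
    unfolding g_def by measurable
  have lim: "AE x in \<mu>. (\<lambda>i. f (r i) x) \<longlonglongrightarrow> g x"
    using conv by eventually_elim (simp add: g_def convergent_LIMSEQ_iff)
  have fatou: "(\<integral>\<^sup>+x. ennreal ((cmod (g x - f m x))\<^sup>2) \<partial>\<mu>) \<le> ennreal (e\<^sup>2)"
    if e: "e > 0" and N: "\<forall>m\<ge>N. \<forall>n\<ge>N. nrm \<mu> (\<lambda>x. f m x - f n x) < e" and m: "m \<ge> N"
    for e N m
  proof -
    have "AE x in \<mu>. ennreal ((cmod (g x - f m x))\<^sup>2)
        = liminf (\<lambda>k. ennreal ((cmod (f (r k) x - f m x))\<^sup>2))"
      using lim
    proof eventually_elim
      case (elim x)
      then have "(\<lambda>k. ennreal ((cmod (f (r k) x - f m x))\<^sup>2))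
          \<longlonglongrightarrow> ennreal ((cmod (g x - f m x))\<^sup>2)"
        by (intro tendsto_ennrealI tendsto_intros)
      then show ?case
        by (simp add: lim_imp_Liminf del: tendsto_ennreal_iff)
    qed
    then have "(\<integral>\<^sup>+x. ennreal ((cmod (g x - f m x))\<^sup>2) \<partial>\<mu>)
        = (\<integral>\<^sup>+x. liminf (\<lambda>k. ennreal ((cmod (f (r k) x - f m x))\<^sup>2)) \<partial>\<mu>)"
      by (rule nn_integral_cong_AE)
    also have "\<dots> \<le> liminf (\<lambda>k. \<integral>\<^sup>+x. ennreal ((cmod (f (r k) x - f m x))\<^sup>2) \<partial>\<mu>)"
      by (rule nn_integral_liminf) measurable
    also have "\<dots> \<le> limsup (\<lambda>k. \<integral>\<^sup>+x. ennreal ((cmod (f (r k) x - f m x))\<^sup>2) \<partial>\<mu>)"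
      by (intro Liminf_le_Limsup) simp
    also have "\<dots> \<le> ennreal (e\<^sup>2)"
    proof (rule Limsup_bounded)
      show "\<forall>\<^sub>F k in sequentially. (\<integral>\<^sup>+x. ennreal ((cmod (f (r k) x - f m x))\<^sup>2) \<partial>\<mu>) \<le> ennreal (e\<^sup>2)"
      proof (rule eventually_sequentiallyI[of N])
        fix k assume "k \<ge> N"
        then have "r k \<ge> N"
          using seq_suble[OF r, of k] by simp
        then have "nrm \<mu> (\<lambda>x. f (r k) x - f m x) \<le> e"
          using N m less_imp_le by blast
        then show "(\<integral>\<^sup>+x. ennreal ((cmod (f (r k) x - f m x))\<^sup>2) \<partial>\<mu>) \<le> ennreal (e\<^sup>2)"
          unfolding nrm_sq_nn_integral[OF sq_integrable_diff[OF f f]]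
          by (simp add: ennreal_leI power_mono)
      qed
    qed
    finally show ?thesis .
  qed
  have diff: "(\<lambda>x. g x - f m x) \<in> sq_integrable \<mu>"
    if "e > 0" "\<forall>m\<ge>N. \<forall>n\<ge>N. nrm \<mu> (\<lambda>x. f m x - f n x) < e" "m \<ge> N" for e N m
    using fatou[OF that] ennreal_less_top[of "e\<^sup>2"]
    by (simp add: sq_integrable_def integrable_iff_bounded le_less_trans)
  show thesis
  proof
    obtain N where "\<forall>m\<ge>N. \<forall>n\<ge>N. nrm \<mu> (\<lambda>x. f m x - f n x) < 1"
      using cauchy[of 1] by auto
    from diff[OF zero_less_one this order_refl] show "g \<in> sq_integrable \<mu>"
      using sq_integrable_add[OF _ f[of N]] by fastforce
    then have d: "(\<lambda>x. g x - f n x) \<in> sq_integrable \<mu>" for n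
      using f by (intro sq_integrable_diff)
    show "(\<lambda>n. nrm \<mu> (\<lambda>x. g x - f n x)) \<longlonglongrightarrow> 0"
    proof (rule LIMSEQ_I)
      fix e :: real assume "e > 0"
      then have e: "e / 2 > 0" by simp
      obtain N where N: "\<forall>m\<ge>N. \<forall>n\<ge>N. nrm \<mu> (\<lambda>x. f m x - f n x) < e / 2"
        using cauchy[OF e] by auto
      have "nrm \<mu> (\<lambda>x. g x - f n x) < e" if "n \<ge> N" for n
      proof -
        have "(nrm \<mu> (\<lambda>x. g x - f n x))\<^sup>2 \<le> (e / 2)\<^sup>2"
          using fatou[OF e N that] unfolding nrm_sq_nn_integral[OF d] by simp
        then have "nrm \<mu> (\<lambda>x. g x - f n x) \<le> e / 2"
          by (rule power2_le_imp_le) (use e in simp)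
        then show ?thesis using \<open>e > 0\<close> by simp
      qed
      then show "\<exists>N. \<forall>n\<ge>N. norm (nrm \<mu> (\<lambda>x. g x - f n x) - 0) < e"
        by auto
    qed
  qed
qed

text \<open>
  The nearest point \<open>p\<close> to \<open>f\<close> in the closure of a linear space \<open>U\<close> of functions, given by a sequence
  in \<open>U\<close> that converges to it. The minimality of the distance forces the residual \<open>f - p\<close> to be
  orthogonal to \<open>U\<close>.
\<close>

lemma projection_onto_closure:
  assumes P: "prob_space \<mu>"
    and U: "U \<subseteq> sq_integrable \<mu>" "U \<noteq> {}"
    and add: "\<And>u v. u \<in> U \<Longrightarrow> v \<in> U \<Longrightarrow> (\<lambda>x. u x + v x) \<in> U"
    and scale: "\<And>c u. u \<in> U \<Longrightarrow> (\<lambda>x. c * u x) \<in> U"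
    and f: "f \<in> sq_integrable \<mu>"
  obtains p u where "p \<in> sq_integrable \<mu>" "\<And>n::nat. u n \<in> U"
    "(\<lambda>n. nrm \<mu> (\<lambda>x. p x - u n x)) \<longlonglongrightarrow> 0"
    "\<And>v. v \<in> U \<Longrightarrow> ip \<mu> v (\<lambda>x. f x - p x) = 0"
proof -
  define D where "D = (\<lambda>u. nrm \<mu> (\<lambda>x. f x - u x)) ` U"
  define d where "d = Inf D"
  have bdd: "bdd_below D"
    unfolding D_def by (intro bdd_belowI[of _ 0]) auto
  have d_le: "d \<le> nrm \<mu> (\<lambda>x. f x - u x)" if "u \<in> U" for u
    unfolding d_def D_def by (rule cInf_lower) (use that bdd in \<open>auto simp: D_def\<close>)
  have d0: "d \<ge> 0"
    unfolding d_def D_def by (rule cInf_greatest) (use U in auto)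
  have fu: "(\<lambda>x. f x - u x) \<in> sq_integrable \<mu>" if "u \<in> U" for u
    using U that f sq_integrable_diff by blast
  have "\<exists>u. u \<in> U \<and> nrm \<mu> (\<lambda>x. f x - u x) < d + inverse (real (Suc n))" for n
  proof -
    have "\<exists>y\<in>D. y < d + inverse (real (Suc n))"
      using U(2) unfolding d_def by (subst cInf_less_iff[symmetric]) (auto simp: D_def bdd[unfolded D_def])
    then show ?thesis unfolding D_def by auto
  qed
  then obtain u where u: "\<And>n. u n \<in> U"
    and u_d: "\<And>n. nrm \<mu> (\<lambda>x. f x - u n x) < d + inverse (real (Suc n))"
    by metis
  have uH: "u n \<in> sq_integrable \<mu>" for n using u U by auto
  \<comment> \<open>The parallelogram identity makes a minimising sequence Cauchy: the midpoint of two
      near-minimisers is itself in \<open>U\<close>, hence at distance at least \<open>d\<close> from \<open>f\<close>.\<close>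
  have close: "(nrm \<mu> (\<lambda>x. u m x - u n x))\<^sup>2 \<le> 4 * ((d + e)\<^sup>2 - d\<^sup>2)"
    if m: "inverse (real (Suc m)) \<le> e" and n: "inverse (real (Suc n)) \<le> e" for m n e
  proof -
    have "(\<lambda>x. 1/2 * (u m x + u n x)) \<in> U"
      by (intro scale add u)
    then have "d \<le> nrm \<mu> (\<lambda>x. f x - 1/2 * (u m x + u n x))"
      by (rule d_le)
    also have "\<dots> = nrm \<mu> (\<lambda>x. 1/2 * ((f x - u n x) + (f x - u m x)))"
      by (intro arg_cong[where f = "nrm \<mu>"] ext) (simp add: field_simps)
    also have "\<dots> = 1/2 * nrm \<mu> (\<lambda>x. (f x - u n x) + (f x - u m x))"
      by (subst nrm_scale) simp
    finally have "(2 * d)\<^sup>2 \<le> (nrm \<mu> (\<lambda>x. (f x - u n x) + (f x - u m x)))\<^sup>2"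
      using d0 by (intro power_mono) auto
    moreover have "(nrm \<mu> (\<lambda>x. f x - u n x))\<^sup>2 \<le> (d + e)\<^sup>2" "(nrm \<mu> (\<lambda>x. f x - u m x))\<^sup>2 \<le> (d + e)\<^sup>2"
      using u_d[of n] u_d[of m] m n by (auto intro!: power_mono)
    ultimately show ?thesis
      using nrm_parallelogram[OF fu[OF u[of n]] fu[OF u[of m]]] by simp
  qed
  obtain p where p: "p \<in> sq_integrable \<mu>" and lim: "(\<lambda>n. nrm \<mu> (\<lambda>x. p x - u n x)) \<longlonglongrightarrow> 0"
  proof (rule Riesz_Fischer[OF P uH])
    fix e :: real assume e: "e > 0"
    have "(\<lambda>n. 4 * ((d + inverse (real (Suc n)))\<^sup>2 - d\<^sup>2)) \<longlonglongrightarrow> 4 * ((d + 0)\<^sup>2 - d\<^sup>2)"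
      by (intro tendsto_intros LIMSEQ_inverse_real_of_nat)
    then have "\<forall>\<^sub>F n in sequentially. 4 * ((d + inverse (real (Suc n)))\<^sup>2 - d\<^sup>2) < e\<^sup>2"
      using e by (intro order_tendstoD(2)) auto
    then obtain N where N: "4 * ((d + inverse (real (Suc N)))\<^sup>2 - d\<^sup>2) < e\<^sup>2"
      by (auto simp: eventually_sequentially)
    have "nrm \<mu> (\<lambda>x. u m x - u n x) < e" if "m \<ge> N" "n \<ge> N" for m n
    proof -
      have "(nrm \<mu> (\<lambda>x. u m x - u n x))\<^sup>2 < e\<^sup>2"
        using close[of m "inverse (real (Suc N))" n] that N
        by (fastforce simp: le_imp_inverse_le)
      then show ?thesis
        by (rule power2_less_imp_less) (use e in simp)
    qed
    then show "\<exists>N. \<forall>m\<ge>N. \<forall>n\<ge>N. nrm \<mu> (\<lambda>x. u m x - u n x) < e" by blast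
  qed
  let ?w = "\<lambda>x. f x - p x"
  have wH: "?w \<in> sq_integrable \<mu>" using f p by (rule sq_integrable_diff)
  have w_le: "nrm \<mu> ?w \<le> d"
  proof (rule LIMSEQ_le_const)
    have "(\<lambda>n. d + inverse (real (Suc n)) + nrm \<mu> (\<lambda>x. p x - u n x)) \<longlonglongrightarrow> d + 0 + 0"
      by (intro tendsto_intros LIMSEQ_inverse_real_of_nat lim)
    then show "(\<lambda>n. d + inverse (real (Suc n)) + nrm \<mu> (\<lambda>x. p x - u n x)) \<longlonglongrightarrow> d"
      by simp
    have "nrm \<mu> ?w \<le> d + inverse (real (Suc n)) + nrm \<mu> (\<lambda>x. p x - u n x)" for n
      using nrm_triangle_diff[OF f uH p, of n] u_d[of n] nrm_minus_commute[of \<mu> p "u n"] by simp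
    then show "\<exists>N. \<forall>n\<ge>N. nrm \<mu> ?w \<le> d + inverse (real (Suc n)) + nrm \<mu> (\<lambda>x. p x - u n x)"
      by blast
  qed
  have w_ge: "d \<le> nrm \<mu> (\<lambda>x. ?w x - v x)" if "v \<in> U" for v
  proof (rule LIMSEQ_le_const)
    show "(\<lambda>n. nrm \<mu> (\<lambda>x. ?w x - v x) + nrm \<mu> (\<lambda>x. p x - u n x)) \<longlonglongrightarrow> nrm \<mu> (\<lambda>x. ?w x - v x)"
      using tendsto_add[OF tendsto_const lim] by simp
    have vH: "v \<in> sq_integrable \<mu>" using that U by auto
    have "d \<le> nrm \<mu> (\<lambda>x. ?w x - v x) + nrm \<mu> (\<lambda>x. p x - u n x)" for n
    proof -
      have "d \<le> nrm \<mu> (\<lambda>x. f x - (v x + u n x))"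
        using add[OF that u] by (rule d_le)
      also have "\<dots> = nrm \<mu> (\<lambda>x. (?w x - v x) + (p x - u n x))"
        by (intro arg_cong[where f = "nrm \<mu>"] ext) simp
      also have "\<dots> \<le> nrm \<mu> (\<lambda>x. ?w x - v x) + nrm \<mu> (\<lambda>x. p x - u n x)"
        by (intro nrm_triangle sq_integrable_diff f p uH vH)
      finally show ?thesis .
    qed
    then show "\<exists>N. \<forall>n\<ge>N. d \<le> nrm \<mu> (\<lambda>x. ?w x - v x) + nrm \<mu> (\<lambda>x. p x - u n x)"
      by blast
  qed
  have orth: "ip \<mu> v ?w = 0" if v: "v \<in> U" for v
  proof (rule ccontr)
    assume neq: "ip \<mu> v ?w \<noteq> 0"
    have vH: "v \<in> sq_integrable \<mu>" using v U by auto
    let ?a = "ip \<mu> v ?w"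
    \<comment> \<open>Adding \<open>t * ?a\<close> times \<open>v\<close> to \<open>p\<close> would bring it closer to \<open>f\<close>; the
        optimal \<open>t\<close> is \<open>1 / (nrm v)\<^sup>2\<close>, and the added 1 covers the case that \<open>v\<close> is null.\<close>
    define t where "t = inverse (1 + (nrm \<mu> v)\<^sup>2)"
    have t: "t > 0" "t * (nrm \<mu> v)\<^sup>2 \<le> 1"
      unfolding t_def by (auto simp: field_simps add_pos_nonneg)
    have "(nrm \<mu> ?w)\<^sup>2 \<le> (nrm \<mu> (\<lambda>x. ?w x - (of_real t * ?a) * v x))\<^sup>2"
      using w_le w_ge[OF scale[OF v]] by (intro power_mono) (auto intro: order_trans)
    also have "\<dots> = (nrm \<mu> ?w)\<^sup>2 + (nrm \<mu> (\<lambda>x. - (of_real t * ?a) * v x))\<^sup>2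
        + 2 * Re (ip \<mu> ?w (\<lambda>x. - (of_real t * ?a) * v x))"
      using nrm_sq_add[OF wH sq_integrable_scale[OF vH, of "- (of_real t * ?a)"]] by simp
    also have "(nrm \<mu> (\<lambda>x. - (of_real t * ?a) * v x))\<^sup>2 = t\<^sup>2 * (cmod ?a)\<^sup>2 * (nrm \<mu> v)\<^sup>2"
      using t unfolding nrm_scale by (simp add: norm_mult power_mult_distrib)
    also have "ip \<mu> ?w (\<lambda>x. - (of_real t * ?a) * v x) = - of_real (t * (cmod ?a)\<^sup>2)"
      unfolding ip_scale_right ip_commute[of \<mu> ?w v] of_real_mult complex_norm_square by simp
    finally have "2 * (t * (cmod ?a)\<^sup>2) \<le> (t * (nrm \<mu> v)\<^sup>2) * (t * (cmod ?a)\<^sup>2)"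
      by (simp add: power2_eq_square algebra_simps)
    also have "\<dots> \<le> 1 * (t * (cmod ?a)\<^sup>2)"
      using t by (intro mult_right_mono) auto
    finally show False using t neq by simp
  qed
  show thesis
    using that[OF p u lim orth] .
qed


section \<open>Square-integrable functions modulo null sets\<close>

lemma equiv_ae_eq: "equiv (sq_integrable \<mu>) (ae_eq \<mu>)"
proof (rule equivI)
  show "ae_eq \<mu> \<subseteq> sq_integrable \<mu> \<times> sq_integrable \<mu>"
    by (auto simp: ae_eq_def)
  show "refl_on (sq_integrable \<mu>) (ae_eq \<mu>)"
    by (auto simp: refl_on_def ae_eq_def)
  show "sym (ae_eq \<mu>)"
    by (auto simp: sym_def ae_eq_def)
  show "trans (ae_eq \<mu>)"
  proof (rule transI)
    fix f g h assume "(f, g) \<in> ae_eq \<mu>" "(g, h) \<in> ae_eq \<mu>"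
    then show "(f, h) \<in> ae_eq \<mu>"
      unfolding ae_eq_def by (auto elim: eventually_elim2)
  qed
qed

lemma cls_in_L2: "f \<in> sq_integrable \<mu> \<Longrightarrow> cls \<mu> f \<in> L2 \<mu>"
  unfolding L2_def cls_def by (rule quotientI)

lemma cls_eq_iff:
  assumes "f \<in> sq_integrable \<mu>" "g \<in> sq_integrable \<mu>"
  shows "cls \<mu> f = cls \<mu> g \<longleftrightarrow> (AE x in \<mu>. f x = g x)"
  unfolding cls_def using eq_equiv_class_iff[OF equiv_ae_eq assms] assms
  by (simp add: ae_eq_def)

lemma
  assumes "F \<in> L2 \<mu>"
  shows rep_sq_integrable: "rep F \<in> sq_integrable \<mu>" and cls_rep: "cls \<mu> (rep F) = F"
proof -
  obtain f where f: "f \<in> sq_integrable \<mu>" "F = ae_eq \<mu> `` {f}"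
    using assms unfolding L2_def by (rule quotientE)
  then have "f \<in> F"
    using equiv_class_self[OF equiv_ae_eq] by blast
  then have "rep F \<in> F"
    unfolding rep_def by (rule someI[where P = "\<lambda>f. f \<in> F"])
  then have "(f, rep F) \<in> ae_eq \<mu>"
    using f by simp
  then show "rep F \<in> sq_integrable \<mu>"
    by (simp add: ae_eq_def)
  show "cls \<mu> (rep F) = F"
    unfolding cls_def f(2)[symmetric]
    using equiv_class_eq[OF equiv_ae_eq \<open>(f, rep F) \<in> ae_eq \<mu>\<close>] f(2) by metis
qed

lemma rep_measurable: "F \<in> L2 \<mu> \<Longrightarrow> rep F \<in> borel_measurable \<mu>"
  using rep_sq_integrable by (simp add: sq_integrable_def)

lemma rep_cls_AE: "f \<in> sq_integrable \<mu> \<Longrightarrow> AE x in \<mu>. rep (cls \<mu> f) x = f x"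
  using cls_eq_iff[of "rep (cls \<mu> f)" \<mu> f] by (simp add: cls_in_L2 rep_sq_integrable cls_rep)

lemma L2_eqI: "F \<in> L2 \<mu> \<Longrightarrow> G \<in> L2 \<mu> \<Longrightarrow> AE x in \<mu>. rep F x = rep G x \<Longrightarrow> F = G"
  using cls_eq_iff[of "rep F" \<mu> "rep G"] by (simp add: rep_sq_integrable cls_rep)

lemma l2_zero_in_L2: "l2_zero \<mu> \<in> L2 \<mu>"
  and l2_add_in_L2: "F \<in> L2 \<mu> \<Longrightarrow> G \<in> L2 \<mu> \<Longrightarrow> l2_add \<mu> F G \<in> L2 \<mu>"
  and l2_scale_in_L2: "F \<in> L2 \<mu> \<Longrightarrow> l2_scale \<mu> c F \<in> L2 \<mu>"
  unfolding l2_zero_def l2_add_def l2_scale_def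
  by (intro cls_in_L2 sq_integrable_intros rep_sq_integrable; assumption)+

lemmas L2_intros = l2_zero_in_L2 l2_add_in_L2 l2_scale_in_L2

lemma rep_zero_AE: "AE x in \<mu>. rep (l2_zero \<mu>) x = 0"
  and rep_add_AE:
    "F \<in> L2 \<mu> \<Longrightarrow> G \<in> L2 \<mu> \<Longrightarrow> AE x in \<mu>. rep (l2_add \<mu> F G) x = rep F x + rep G x"
  and rep_scale_AE: "F \<in> L2 \<mu> \<Longrightarrow> AE x in \<mu>. rep (l2_scale \<mu> c F) x = c * rep F x"
  unfolding l2_zero_def l2_add_def l2_scale_def
  by (intro rep_cls_AE sq_integrable_intros rep_sq_integrable; assumption)+

lemma l2_inner_eq_ip: "l2_inner \<mu> F G = ip \<mu> (rep F) (rep G)"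
  by (simp add: l2_inner_def ip_def)

lemma l2_inner_cls_right:
  assumes "F \<in> L2 \<mu>" "g \<in> sq_integrable \<mu>"
  shows "l2_inner \<mu> F (cls \<mu> g) = ip \<mu> (rep F) g"
  unfolding l2_inner_eq_ip using assms
  by (intro ip_cong_AE rep_cls_AE)
     (auto simp: rep_measurable cls_in_L2 sq_integrable_measurable)

lemma l2_inner_commute: "l2_inner \<mu> G F = cnj (l2_inner \<mu> F G)"
  unfolding l2_inner_eq_ip by (rule ip_commute)

lemma l2_inner_cls_left:
  assumes "G \<in> L2 \<mu>" "f \<in> sq_integrable \<mu>"
  shows "l2_inner \<mu> (cls \<mu> f) G = ip \<mu> f (rep G)"
  using l2_inner_cls_right[OF assms] l2_inner_commute[of \<mu> "cls \<mu> f" G] ip_commute[of \<mu> f "rep G"]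
  by simp

lemma l2_inner_eq_0_commute: "l2_inner \<mu> F G = 0 \<longleftrightarrow> l2_inner \<mu> G F = 0"
  using l2_inner_commute[of \<mu> G F] by simp

lemma l2_inner_add_right:
  assumes "F \<in> L2 \<mu>" "G \<in> L2 \<mu>" "H \<in> L2 \<mu>"
  shows "l2_inner \<mu> F (l2_add \<mu> G H) = l2_inner \<mu> F G + l2_inner \<mu> F H"
  using assms unfolding l2_add_def
  by (subst l2_inner_cls_right)
     (simp_all add: sq_integrable_add rep_sq_integrable ip_add_right l2_inner_eq_ip)

lemma l2_inner_scale_right:
  assumes "F \<in> L2 \<mu>" "G \<in> L2 \<mu>"
  shows "l2_inner \<mu> F (l2_scale \<mu> c G) = c * l2_inner \<mu> F G"
  using assms unfolding l2_scale_def
  by (subst l2_inner_cls_right)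
     (simp_all add: sq_integrable_scale rep_sq_integrable ip_scale_right l2_inner_eq_ip)

lemma l2_inner_scale_left:
  assumes "F \<in> L2 \<mu>" "G \<in> L2 \<mu>"
  shows "l2_inner \<mu> (l2_scale \<mu> c F) G = cnj c * l2_inner \<mu> F G"
  unfolding l2_inner_commute[of \<mu> _ G] by (simp add: l2_inner_scale_right assms)

lemma l2_inner_zero_right: "F \<in> L2 \<mu> \<Longrightarrow> l2_inner \<mu> F (l2_zero \<mu>) = 0"
  unfolding l2_zero_def by (simp add: l2_inner_cls_right sq_integrable_zero) (simp add: ip_def)

lemma l2_inner_self_eq_0:
  assumes "F \<in> L2 \<mu>" "l2_inner \<mu> F F = 0"
  shows "F = l2_zero \<mu>"
proof (rule L2_eqI)
  have "nrm \<mu> (rep F) = 0"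
    using assms(2) by (simp add: l2_inner_eq_ip ip_self)
  then have "AE x in \<mu>. rep F x = 0"
    using assms by (simp add: nrm_eq_0_iff rep_sq_integrable)
  then show "AE x in \<mu>. rep F x = rep (l2_zero \<mu>) x"
    using rep_zero_AE by eventually_elim simp
qed (use assms in \<open>simp_all add: l2_zero_in_L2\<close>)

lemma l2_dist_eq_nrm: "l2_dist \<mu> F G = nrm \<mu> (\<lambda>x. rep F x - rep G x)"
  by (simp add: l2_dist_def nrm_def)

lemma rep_diff_sq_integrable:
  "F \<in> L2 \<mu> \<Longrightarrow> G \<in> L2 \<mu> \<Longrightarrow> (\<lambda>x. rep F x - rep G x) \<in> sq_integrable \<mu>"
  by (intro sq_integrable_diff rep_sq_integrable)

lemma l2_dist_cong_AE:
  assumes "F \<in> L2 \<mu>" "G \<in> L2 \<mu>" "h \<in> sq_integrable \<mu>"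
    and "AE x in \<mu>. rep F x - rep G x = h x"
  shows "l2_dist \<mu> F G = nrm \<mu> h"
  unfolding l2_dist_eq_nrm using assms
  by (intro nrm_cong_AE) (simp_all add: sq_integrable_measurable rep_diff_sq_integrable)

lemma Metric_space_L2: "Metric_space (L2 \<mu>) (l2_dist \<mu>)"
proof
  fix F G H
  show "0 \<le> l2_dist \<mu> F G"
    by (simp add: l2_dist_eq_nrm)
  show "l2_dist \<mu> F G = l2_dist \<mu> G F"
    unfolding l2_dist_eq_nrm by (rule nrm_minus_commute)
  assume F: "F \<in> L2 \<mu>" and G: "G \<in> L2 \<mu>"
  then have "l2_dist \<mu> F G = 0 \<longleftrightarrow> (AE x in \<mu>. rep F x = rep G x)"
    unfolding l2_dist_eq_nrm by (simp add: nrm_eq_0_iff rep_diff_sq_integrable)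
  then show "l2_dist \<mu> F G = 0 \<longleftrightarrow> F = G"
    using L2_eqI[OF F G] by auto
  assume H: "H \<in> L2 \<mu>"
  show "l2_dist \<mu> F H \<le> l2_dist \<mu> F G + l2_dist \<mu> G H"
    unfolding l2_dist_eq_nrm by (intro nrm_triangle_diff rep_sq_integrable F G H)
qed

lemma topspace_l2_topology: "topspace (l2_topology \<mu>) = L2 \<mu>"
  by (simp add: l2_topology_def Metric_space.topspace_mtopology[OF Metric_space_L2])

lemma in_l2_closure_iff:
  assumes "A \<subseteq> L2 \<mu>"
  shows "F \<in> l2_topology \<mu> closure_of A \<longleftrightarrow>
    F \<in> L2 \<mu> \<and> (\<forall>e>0. \<exists>G\<in>A. l2_dist \<mu> F G < e)"
proof -
  interpret Metric_space "L2 \<mu>" "l2_dist \<mu>" by (rule Metric_space_L2)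
  have "G \<in> mball F e \<longleftrightarrow> F \<in> L2 \<mu> \<and> l2_dist \<mu> F G < e" if "G \<in> A" for G e
    using that assms by auto
  then show ?thesis
    unfolding l2_topology_def metric_closure_of by blast
qed

lemma in_graph_closure_iff:
  assumes "S \<subseteq> L2 \<mu> \<times> L2 \<mu>"
  shows "(F, K) \<in> graph_topology \<mu> closure_of S \<longleftrightarrow>
    F \<in> L2 \<mu> \<and> K \<in> L2 \<mu> \<and>
    (\<forall>e>0. \<exists>(F', K')\<in>S. l2_dist \<mu> F F' < e \<and> l2_dist \<mu> K K' < e)"
proof -
  interpret Metric_space12 "L2 \<mu>" "l2_dist \<mu>" "L2 \<mu>" "l2_dist \<mu>"
    by (intro Metric_space12.intro Metric_space_L2)
  have "graph_topology \<mu> = Prod_metric.mtopology"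
    by (simp add: graph_topology_def l2_topology_def mtopology_prod_metric)
  then have *: "(F, K) \<in> graph_topology \<mu> closure_of S \<longleftrightarrow>
      F \<in> L2 \<mu> \<and> K \<in> L2 \<mu> \<and>
      (\<forall>e>0. \<exists>P\<in>S. P \<in> Prod_metric.mball (F, K) e)"
    by (simp add: Prod_metric.metric_closure_of)
  have "(\<forall>e>0. \<exists>P\<in>S. P \<in> Prod_metric.mball (F, K) e) \<longleftrightarrow>
      (\<forall>e>0. \<exists>(F', K')\<in>S. l2_dist \<mu> F F' < e \<and> l2_dist \<mu> K K' < e)"
    if "F \<in> L2 \<mu>" "K \<in> L2 \<mu>"
  proof (intro iffI allI impI)
    fix e :: real assume "\<forall>e>0. \<exists>P\<in>S. P \<in> Prod_metric.mball (F, K) e" "e > 0"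
    then obtain P where "P \<in> S" "P \<in> Prod_metric.mball (F, K) e" by blast
    then show "\<exists>(F', K')\<in>S. l2_dist \<mu> F F' < e \<and> l2_dist \<mu> K K' < e"
      using mball_prod_metric_subset[of F K e] by (cases P) fastforce
  next
    fix e :: real
    assume e: "\<forall>e>0. \<exists>(F', K')\<in>S. l2_dist \<mu> F F' < e \<and> l2_dist \<mu> K K' < e" "e > 0"
    then obtain F' K' where "(F', K') \<in> S" "l2_dist \<mu> F F' < e / 2" "l2_dist \<mu> K K' < e / 2"
      using half_gt_zero[OF e(2)] by blast
    then show "\<exists>P\<in>S. P \<in> Prod_metric.mball (F, K) e"
      using that assms mball_subset_prod_metric[of F "e / 2" K "e / 2"] by fastforce
  qed
  then show ?thesis using * by blast
qed

section \<open>Orthogonal complements\<close>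

definition orth :: "real measure \<Rightarrow> l2vec set \<Rightarrow> l2vec set" where
  "orth \<mu> A = {G \<in> L2 \<mu>. \<forall>F\<in>A. l2_inner \<mu> F G = 0}"

lemma orth_subset_L2: "orth \<mu> A \<subseteq> L2 \<mu>"
  by (auto simp: orth_def)

lemma l2_subspace_orth: "A \<subseteq> L2 \<mu> \<Longrightarrow> l2_subspace \<mu> (orth \<mu> A)"
  unfolding l2_subspace_def orth_def
  by (intro conjI ballI allI)
     (auto simp: L2_intros l2_inner_add_right l2_inner_scale_right l2_inner_zero_right subset_iff)

lemma subset_orth_orth: "A \<subseteq> L2 \<mu> \<Longrightarrow> A \<subseteq> orth \<mu> (orth \<mu> A)"
  by (auto simp: orth_def l2_inner_eq_0_commute)

lemma l2_inner_diff_bound: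
  assumes "A \<in> L2 \<mu>" "F \<in> L2 \<mu>" "G \<in> L2 \<mu>"
  shows "cmod (l2_inner \<mu> A F - l2_inner \<mu> A G) \<le> nrm \<mu> (rep A) * l2_dist \<mu> F G"
  using assms Cauchy_Schwarz_ip[of "rep A" \<mu> "\<lambda>x. rep F x - rep G x"]
  by (simp add: l2_inner_eq_ip l2_dist_eq_nrm ip_diff_right rep_sq_integrable rep_diff_sq_integrable)

lemma closedin_orth:
  assumes A: "A \<subseteq> L2 \<mu>"
  shows "closedin (l2_topology \<mu>) (orth \<mu> A)"
proof -
  have "F \<in> orth \<mu> A" if "F \<in> l2_topology \<mu> closure_of (orth \<mu> A)" for F
  proof -
    have F: "F \<in> L2 \<mu>" and near: "\<forall>e>0. \<exists>G\<in>orth \<mu> A. l2_dist \<mu> F G < e"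
      using that by (auto simp: in_l2_closure_iff orth_subset_L2)
    have "l2_inner \<mu> a F = 0" if a: "a \<in> A" for a
    proof (rule ccontr)
      assume "l2_inner \<mu> a F \<noteq> 0"
      then have pos: "cmod (l2_inner \<mu> a F) / (nrm \<mu> (rep a) + 1) > 0"
        by (simp add: add_nonneg_pos)
      then obtain G where G: "G \<in> orth \<mu> A"
        and d: "l2_dist \<mu> F G < cmod (l2_inner \<mu> a F) / (nrm \<mu> (rep a) + 1)"
        using near by blast
      have "cmod (l2_inner \<mu> a F) \<le> nrm \<mu> (rep a) * l2_dist \<mu> F G"
        using l2_inner_diff_bound[of a \<mu> F G] a A F G by (auto simp: orth_def)
      also have "\<dots> \<le> (nrm \<mu> (rep a) + 1) * l2_dist \<mu> F G"
        by (intro mult_right_mono) (auto simp: l2_dist_eq_nrm)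
      also have "\<dots> < cmod (l2_inner \<mu> a F)"
        using d by (simp add: pos_less_divide_eq add_nonneg_pos mult.commute)
      finally show False by simp
    qed
    then show ?thesis using F by (simp add: orth_def)
  qed
  then show ?thesis
    using closure_of_subset[of "orth \<mu> A" "l2_topology \<mu>"] orth_subset_L2
    by (intro closure_of_eq[THEN iffD1]) (auto simp: topspace_l2_topology)
qed

text \<open>
  The bipolar theorem for \<open>L\<^sup>2(\<mu>)\<close>. It is the only place where completeness enters: if \<open>F\<close> is
  orthogonal to everything orthogonal to \<open>W\<close>, its residual \<open>w\<close> after projection onto the closure of
  \<open>W\<close> is orthogonal both to \<open>F\<close> and to the projection, hence to itself.
\<close>

lemma orth_orth_eq_closure:
  assumes P: "prob_space \<mu>" and W: "l2_subspace \<mu> W"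
  shows "orth \<mu> (orth \<mu> W) = l2_topology \<mu> closure_of W"
proof
  have WL: "W \<subseteq> L2 \<mu>" using W by (simp add: l2_subspace_def)
  show "l2_topology \<mu> closure_of W \<subseteq> orth \<mu> (orth \<mu> W)"
    by (intro closure_of_minimal subset_orth_orth closedin_orth orth_subset_L2 WL)
  show "orth \<mu> (orth \<mu> W) \<subseteq> l2_topology \<mu> closure_of W"
  proof
    fix F assume F: "F \<in> orth \<mu> (orth \<mu> W)"
    then have FL: "F \<in> L2 \<mu>" by (simp add: orth_def)
    define f where "f = rep F"
    have f: "f \<in> sq_integrable \<mu>" using FL by (simp add: f_def rep_sq_integrable)
    \<comment> \<open>All functions whose class lies in \<open>W\<close>: unlike the chosen representatives, they are closed
        under pointwise sums.\<close>
    define U where "U = {u \<in> sq_integrable \<mu>. cls \<mu> u \<in> W}"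
    have U: "U \<subseteq> sq_integrable \<mu>" "U \<noteq> {}"
      using W sq_integrable_zero by (auto simp: U_def l2_subspace_def l2_zero_def)
    have add: "(\<lambda>x. u x + v x) \<in> U" if "u \<in> U" "v \<in> U" for u v
    proof -
      have uv: "u \<in> sq_integrable \<mu>" "v \<in> sq_integrable \<mu>"
        using that by (auto simp: U_def)
      have "AE x in \<mu>. u x + v x = rep (cls \<mu> u) x + rep (cls \<mu> v) x"
        using rep_cls_AE[OF uv(1)] rep_cls_AE[OF uv(2)] by eventually_elim simp
      then have "cls \<mu> (\<lambda>x. u x + v x) = l2_add \<mu> (cls \<mu> u) (cls \<mu> v)"
        unfolding l2_add_def using uv
        by (subst cls_eq_iff) (auto intro!: sq_integrable_add rep_sq_integrable cls_in_L2)
      then show ?thesis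
        using that W uv by (simp add: U_def l2_subspace_def sq_integrable_add)
    qed
    have scale: "(\<lambda>x. c * u x) \<in> U" if "u \<in> U" for c u
    proof -
      have u: "u \<in> sq_integrable \<mu>"
        using that by (auto simp: U_def)
      have "AE x in \<mu>. c * u x = c * rep (cls \<mu> u) x"
        using rep_cls_AE[OF u] by eventually_elim simp
      then have "cls \<mu> (\<lambda>x. c * u x) = l2_scale \<mu> c (cls \<mu> u)"
        unfolding l2_scale_def using u
        by (subst cls_eq_iff) (auto intro!: sq_integrable_scale rep_sq_integrable cls_in_L2)
      then show ?thesis
        using that W u by (simp add: U_def l2_subspace_def sq_integrable_scale)
    qed
    obtain p u where p: "p \<in> sq_integrable \<mu>" and u: "\<And>n::nat. u n \<in> U"
      and lim: "(\<lambda>n. nrm \<mu> (\<lambda>x. p x - u n x)) \<longlonglongrightarrow> 0"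
      and perp: "\<And>v. v \<in> U \<Longrightarrow> ip \<mu> v (\<lambda>x. f x - p x) = 0"
      using projection_onto_closure[OF P U add scale f] by blast
    let ?w = "\<lambda>x. f x - p x"
    have w: "?w \<in> sq_integrable \<mu>" using f p by (rule sq_integrable_diff)
    have uH: "u n \<in> sq_integrable \<mu>" for n using u U by auto
    have "cls \<mu> ?w \<in> orth \<mu> W"
      using WL w perp by (auto simp: orth_def cls_in_L2 l2_inner_cls_right U_def rep_sq_integrable cls_rep
          subset_iff)
    then have "l2_inner \<mu> (cls \<mu> ?w) F = 0"
      using F by (simp add: orth_def)
    then have wf: "ip \<mu> ?w f = 0"
      using w FL by (simp add: l2_inner_cls_left f_def)
    have "(\<lambda>n. nrm \<mu> ?w * nrm \<mu> (\<lambda>x. p x - u n x)) \<longlonglongrightarrow> nrm \<mu> ?w * 0"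
      by (intro tendsto_intros lim)
    moreover have "cmod (ip \<mu> ?w p) \<le> nrm \<mu> ?w * nrm \<mu> (\<lambda>x. p x - u n x)" for n
      using Cauchy_Schwarz_ip[OF w sq_integrable_diff[OF p uH[of n]]]
        ip_diff_right[OF w p uH[of n]] perp[OF u[of n]] ip_commute[of \<mu> ?w "u n"] by simp
    ultimately have "cmod (ip \<mu> ?w p) \<le> nrm \<mu> ?w * 0"
      by (intro LIMSEQ_le_const) auto
    then have "ip \<mu> ?w ?w = 0"
      using wf by (simp add: ip_diff_right[OF w f p])
    then have w0: "nrm \<mu> ?w = 0"
      by (simp add: ip_self)
    have "\<exists>G\<in>W. l2_dist \<mu> F G < e" if e: "e > 0" for e
    proof -
      obtain n where n: "nrm \<mu> (\<lambda>x. p x - u n x) < e"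
        using order_tendstoD(2)[OF lim e] by (auto simp: eventually_sequentially)
      have "AE x in \<mu>. rep F x - rep (cls \<mu> (u n)) x = f x - u n x"
        using rep_cls_AE[OF uH[of n]] by eventually_elim (simp add: f_def)
      then have "l2_dist \<mu> F (cls \<mu> (u n)) = nrm \<mu> (\<lambda>x. f x - u n x)"
        by (intro l2_dist_cong_AE FL cls_in_L2 uH sq_integrable_diff f)
      also have "\<dots> < e"
        using nrm_triangle_diff[OF f p uH[of n]] w0 n by simp
      finally show ?thesis
        using u[of n] by (auto simp: U_def)
    qed
    then show "F \<in> l2_topology \<mu> closure_of W"
      using FL WL by (simp add: in_l2_closure_iff)
  qed
qed

section \<open>The shifted graph of an operator\<close>

text \<open>
  For \<open>(F, K)\<close> in the graph of \<open>T\<close> this is \<open>(T + \<i>)F\<close>, so \<open>shifted \<mu> ` T\<close> is the range of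
  \<open>T + \<i>\<close>. Defining it on pairs makes it available for operators given by their graphs.
\<close>

definition shifted :: "real measure \<Rightarrow> l2vec \<times> l2vec \<Rightarrow> l2vec" where
  "shifted \<mu> = (\<lambda>(F, K). l2_add \<mu> K (l2_scale \<mu> \<i> F))"

lemma shifted_in_L2: "F \<in> L2 \<mu> \<Longrightarrow> K \<in> L2 \<mu> \<Longrightarrow> shifted \<mu> (F, K) \<in> L2 \<mu>"
  by (simp add: shifted_def L2_intros)

lemma rep_shifted_AE:
  assumes "F \<in> L2 \<mu>" "K \<in> L2 \<mu>"
  shows "AE x in \<mu>. rep (shifted \<mu> (F, K)) x = rep K x + \<i> * rep F x"
  using rep_add_AE[OF assms(2) l2_scale_in_L2[OF assms(1), of \<i>]] rep_scale_AE[OF assms(1), of \<i>]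
  unfolding shifted_def by eventually_elim simp

text \<open>
  The equation \<open>S\<^sup>*G = \<i>G\<close> says \<open>\<langle>G, SF\<rangle> = \<langle>\<i>G, F\<rangle> = -\<i>\<langle>G, F\<rangle>\<close> for all \<open>F\<close> in the domain, the inner
  product being conjugate linear in its first argument. Hence the deficiency space is the orthogonal
  complement of the range of \<open>S + \<i>\<close>.
\<close>

lemma DEF_plus_eq_orth:
  assumes S: "S \<subseteq> L2 \<mu> \<times> L2 \<mu>"
  shows "DEF_plus \<mu> S = orth \<mu> (shifted \<mu> ` S)"
proof -
  have *: "l2_inner \<mu> G K = l2_inner \<mu> (l2_scale \<mu> \<i> G) F \<longleftrightarrow> l2_inner \<mu> (shifted \<mu> (F, K)) G = 0"
    if "G \<in> L2 \<mu>" "(F, K) \<in> S" for F G K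
  proof -
    have "F \<in> L2 \<mu>" "K \<in> L2 \<mu>" using that S by auto
    then show ?thesis
      unfolding l2_inner_eq_0_commute[of \<mu> _ G] using that
      by (simp add: shifted_def l2_inner_add_right l2_inner_scale_right l2_inner_scale_left L2_intros
          add_eq_0_iff2)
  qed
  have "DEF_plus \<mu> S = {G \<in> L2 \<mu>. \<forall>(F, K)\<in>S. l2_inner \<mu> G K = l2_inner \<mu> (l2_scale \<mu> \<i> G) F}"
    unfolding DEF_plus_def adjoint_op_def by (auto simp: l2_scale_in_L2 intro!: exI[of _ "l2_scale \<mu> \<i> _"])
  also have "\<dots> = orth \<mu> (shifted \<mu> ` S)"
  proof -
    have "(\<forall>p\<in>S. case p of (F, K) \<Rightarrow> l2_inner \<mu> G K = l2_inner \<mu> (l2_scale \<mu> \<i> G) F) \<longleftrightarrow>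
        (\<forall>A\<in>shifted \<mu> ` S. l2_inner \<mu> A G = 0)" if "G \<in> L2 \<mu>" for G
      using *[OF that] by auto
    then show ?thesis unfolding orth_def by blast
  qed
  finally show ?thesis .
qed

lemma linear_operator_Domain: "linear_operator \<mu> T \<Longrightarrow> l2_subspace \<mu> (Domain T)"
  unfolding l2_subspace_def
proof (intro conjI ballI allI)
  assume T: "linear_operator \<mu> T"
  show "Domain T \<subseteq> L2 \<mu>" "l2_zero \<mu> \<in> Domain T"
    using T by (auto simp: linear_operator_def)
  fix F assume "F \<in> Domain T"
  then obtain K where F: "(F, K) \<in> T" by blast
  then show "l2_scale \<mu> c F \<in> Domain T" for c
    using T unfolding linear_operator_def by blast
  fix F' assume "F' \<in> Domain T"
  then obtain K' where "(F', K') \<in> T" by blast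
  with F show "l2_add \<mu> F F' \<in> Domain T"
    using T unfolding linear_operator_def by blast
qed

lemma shifted_add:
  assumes "F \<in> L2 \<mu>" "K \<in> L2 \<mu>" "F' \<in> L2 \<mu>" "K' \<in> L2 \<mu>"
  shows "l2_add \<mu> (shifted \<mu> (F, K)) (shifted \<mu> (F', K'))
       = shifted \<mu> (l2_add \<mu> F F', l2_add \<mu> K K')"
proof (rule L2_eqI)
  show "AE x in \<mu>. rep (l2_add \<mu> (shifted \<mu> (F, K)) (shifted \<mu> (F', K'))) x
      = rep (shifted \<mu> (l2_add \<mu> F F', l2_add \<mu> K K')) x"
    using rep_add_AE[OF shifted_in_L2[OF assms(1,2)] shifted_in_L2[OF assms(3,4)]]
      rep_shifted_AE[OF assms(1,2)] rep_shifted_AE[OF assms(3,4)]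
      rep_shifted_AE[OF l2_add_in_L2[OF assms(1,3)] l2_add_in_L2[OF assms(2,4)]]
      rep_add_AE[OF assms(1,3)] rep_add_AE[OF assms(2,4)]
    by eventually_elim (simp only: distrib_left add_ac)
qed (use assms in \<open>simp_all add: L2_intros shifted_in_L2\<close>)

lemma shifted_scale:
  assumes "F \<in> L2 \<mu>" "K \<in> L2 \<mu>"
  shows "l2_scale \<mu> c (shifted \<mu> (F, K)) = shifted \<mu> (l2_scale \<mu> c F, l2_scale \<mu> c K)"
proof (rule L2_eqI)
  show "AE x in \<mu>. rep (l2_scale \<mu> c (shifted \<mu> (F, K))) x
      = rep (shifted \<mu> (l2_scale \<mu> c F, l2_scale \<mu> c K)) x"
    using rep_scale_AE[OF shifted_in_L2[OF assms], of c]
      rep_shifted_AE[OF assms]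
      rep_shifted_AE[OF l2_scale_in_L2[OF assms(1), of c] l2_scale_in_L2[OF assms(2), of c]]
      rep_scale_AE[OF assms(1), of c] rep_scale_AE[OF assms(2), of c]
    by eventually_elim (simp only: distrib_left mult.left_commute)
qed (use assms in \<open>simp_all add: L2_intros shifted_in_L2\<close>)

lemma shifted_zero: "shifted \<mu> (l2_zero \<mu>, l2_zero \<mu>) = l2_zero \<mu>"
proof (rule L2_eqI)
  show "AE x in \<mu>. rep (shifted \<mu> (l2_zero \<mu>, l2_zero \<mu>)) x = rep (l2_zero \<mu>) x"
    using rep_shifted_AE[OF l2_zero_in_L2 l2_zero_in_L2, of \<mu>] rep_zero_AE[of \<mu>]
    by eventually_elim simp
qed (simp_all add: L2_intros shifted_in_L2)

lemma linear_operator_shifted_range: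
  assumes T: "linear_operator \<mu> T"
  shows "l2_subspace \<mu> (shifted \<mu> ` T)"
proof -
  have TL: "T \<subseteq> L2 \<mu> \<times> L2 \<mu>" and T0: "(l2_zero \<mu>, l2_zero \<mu>) \<in> T"
    and Tadd: "\<And>F G F' G'. (F, G) \<in> T \<Longrightarrow> (F', G') \<in> T \<Longrightarrow> (l2_add \<mu> F F', l2_add \<mu> G G') \<in> T"
    and Tscale: "\<And>c F G. (F, G) \<in> T \<Longrightarrow> (l2_scale \<mu> c F, l2_scale \<mu> c G) \<in> T"
    using T by (fastforce simp: linear_operator_def)+
  show ?thesis
    unfolding l2_subspace_def
  proof (intro conjI ballI allI)
    show "shifted \<mu> ` T \<subseteq> L2 \<mu>" using TL by (auto intro!: shifted_in_L2)
    show "l2_zero \<mu> \<in> shifted \<mu> ` T"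
      using imageI[OF T0, of "shifted \<mu>"] by (simp add: shifted_zero)
    fix A assume "A \<in> shifted \<mu> ` T"
    then obtain F K where A: "A = shifted \<mu> (F, K)" "(F, K) \<in> T" by auto
    then have L: "F \<in> L2 \<mu>" "K \<in> L2 \<mu>" using TL by auto
    show "l2_scale \<mu> c A \<in> shifted \<mu> ` T" for c
      unfolding A shifted_scale[OF L] by (intro imageI Tscale A)
    fix B assume "B \<in> shifted \<mu> ` T"
    then obtain F' K' where B: "B = shifted \<mu> (F', K')" "(F', K') \<in> T" by auto
    then have L': "F' \<in> L2 \<mu>" "K' \<in> L2 \<mu>" using TL by auto
    show "l2_add \<mu> A B \<in> shifted \<mu> ` T"
      unfolding A B shifted_add[OF L L'] by (intro imageI Tadd A B)
  qed
qed


section \<open>Multiplication by the variable and its shift\<close>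

lemma measurable_of_real_borel:
  "sets \<mu> = sets borel \<Longrightarrow> complex_of_real \<in> borel_measurable \<mu>"
  by (subst measurable_cong_sets[OF _ refl], assumption)
     (intro borel_measurable_continuous_onI continuous_intros)

text \<open>
  Pairs in the graph are defined through some common representative; this form speaks about the
  representatives chosen by \<open>rep\<close> and reduces later claims to almost everywhere identities.
\<close>

lemma mult_op_iff:
  assumes M: "sets \<mu> = sets borel"
  shows "(F, K) \<in> mult_op \<mu> \<longleftrightarrow>
    F \<in> L2 \<mu> \<and> K \<in> L2 \<mu> \<and> (AE x in \<mu>. rep K x = of_real x * rep F x)"
proof
  assume "(F, K) \<in> mult_op \<mu>"
  then obtain f where f: "f \<in> sq_integrable \<mu>" "(\<lambda>x. of_real x * f x) \<in> sq_integrable \<mu>"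
    and FK: "F = cls \<mu> f" "K = cls \<mu> (\<lambda>x. of_real x * f x)"
    unfolding mult_op_def by blast
  have "AE x in \<mu>. rep K x = of_real x * rep F x"
    unfolding FK using rep_cls_AE[OF f(1)] rep_cls_AE[OF f(2)] by eventually_elim simp
  then show "F \<in> L2 \<mu> \<and> K \<in> L2 \<mu> \<and> (AE x in \<mu>. rep K x = of_real x * rep F x)"
    using f FK cls_in_L2 by blast
next
  assume *: "F \<in> L2 \<mu> \<and> K \<in> L2 \<mu> \<and> (AE x in \<mu>. rep K x = of_real x * rep F x)"
  then have F: "rep F \<in> sq_integrable \<mu>" and K: "rep K \<in> sq_integrable \<mu>"
    by (simp_all add: rep_sq_integrable)
  have [measurable]: "rep F \<in> borel_measurable \<mu>" "(\<lambda>x. complex_of_real x) \<in> borel_measurable \<mu>"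
    using F measurable_of_real_borel[OF M] by (auto simp: sq_integrable_measurable)
  have xF: "(\<lambda>x. of_real x * rep F x) \<in> sq_integrable \<mu>"
    by (rule sq_integrable_cong_AE[OF K]) (use * in auto)
  have "cls \<mu> (rep F) = F" "cls \<mu> (\<lambda>x. of_real x * rep F x) = K"
    using * cls_rep cls_eq_iff[OF K xF] by auto
  then show "(F, K) \<in> mult_op \<mu>"
    unfolding mult_op_def using F xF by blast
qed

lemma mult_op_subset_L2: "mult_op \<mu> \<subseteq> L2 \<mu> \<times> L2 \<mu>"
  by (auto simp: mult_op_def cls_in_L2)

lemma rep_shifted_mult_op_AE:
  assumes "sets \<mu> = sets borel" "(F, K) \<in> mult_op \<mu>"
  shows "AE x in \<mu>. rep (shifted \<mu> (F, K)) x = (of_real x + \<i>) * rep F x"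
proof -
  have *: "F \<in> L2 \<mu>" "K \<in> L2 \<mu>" "AE x in \<mu>. rep K x = of_real x * rep F x"
    using assms by (simp_all add: mult_op_iff)
  show ?thesis
    using rep_shifted_AE[OF *(1,2)] *(3) by eventually_elim (simp add: distrib_right)
qed

lemma real_plus_i_nonzero: "complex_of_real x + \<i> \<noteq> 0" "complex_of_real x \<noteq> \<i>"
  by (auto simp: complex_eq_iff)

lemma cmod_real_plus_i_sq: "(cmod (complex_of_real x + \<i>))\<^sup>2 = x\<^sup>2 + 1"
  by (simp add: cmod_power2)

lemma resolvent_bounds:
  "cmod (inverse (complex_of_real x + \<i>)) \<le> 1"
  "cmod (complex_of_real x * inverse (complex_of_real x + \<i>)) \<le> 1"
proof -
  have 1: "1 \<le> cmod (complex_of_real x + \<i>)"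
    by (rule power2_le_imp_le) (simp_all add: cmod_real_plus_i_sq)
  have x: "\<bar>x\<bar> \<le> cmod (complex_of_real x + \<i>)"
    by (rule power2_le_imp_le) (simp_all add: cmod_real_plus_i_sq)
  show "cmod (inverse (complex_of_real x + \<i>)) \<le> 1"
    using 1 by (simp add: norm_inverse inverse_le_1_iff)
  show "cmod (complex_of_real x * inverse (complex_of_real x + \<i>)) \<le> 1"
    using 1 x by (simp add: norm_divide divide_inverse[symmetric] divide_le_eq)
qed

lemma sq_integrable_resolvent:
  assumes M: "sets \<mu> = sets borel" and u: "u \<in> sq_integrable \<mu>"
  shows "(\<lambda>x. inverse (of_real x + \<i>) * u x) \<in> sq_integrable \<mu>"
    and "(\<lambda>x. of_real x * inverse (of_real x + \<i>) * u x) \<in> sq_integrable \<mu>"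
proof -
  have [measurable]: "complex_of_real \<in> borel_measurable \<mu>"
    using M by (rule measurable_of_real_borel)
  show "(\<lambda>x. inverse (of_real x + \<i>) * u x) \<in> sq_integrable \<mu>"
    by (rule sq_integrable_bounded_mult[OF u _ resolvent_bounds(1)]) measurable
  show "(\<lambda>x. of_real x * inverse (of_real x + \<i>) * u x) \<in> sq_integrable \<mu>"
    by (rule sq_integrable_bounded_mult[OF u _ resolvent_bounds(2)]) measurable
qed

text \<open>
  The operator \<open>M + \<i>\<close> maps onto \<open>L\<^sup>2(\<mu>)\<close>, the preimage of \<open>U\<close> being \<open>U(x) / (x + \<i>)\<close>.
\<close>

lemma shifted_mult_op_surj:
  assumes M: "sets \<mu> = sets borel" and U: "U \<in> L2 \<mu>"
  obtains F K where "(F, K) \<in> mult_op \<mu>" "shifted \<mu> (F, K) = U"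
    "AE x in \<mu>. rep F x = inverse (of_real x + \<i>) * rep U x"
proof -
  have u: "rep U \<in> sq_integrable \<mu>" using U by (rule rep_sq_integrable)
  have f: "(\<lambda>x. inverse (of_real x + \<i>) * rep U x) \<in> sq_integrable \<mu>"
    and k: "(\<lambda>x. of_real x * inverse (of_real x + \<i>) * rep U x) \<in> sq_integrable \<mu>"
    using sq_integrable_resolvent[OF M u] by simp_all
  define F where "F = cls \<mu> (\<lambda>x. inverse (of_real x + \<i>) * rep U x)"
  define K where "K = cls \<mu> (\<lambda>x. of_real x * inverse (of_real x + \<i>) * rep U x)"
  have FK: "(F, K) \<in> mult_op \<mu>"
    unfolding mult_op_def F_def K_def using f k by (auto simp: mult.assoc)
  have F: "AE x in \<mu>. rep F x = inverse (of_real x + \<i>) * rep U x"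
    unfolding F_def by (rule rep_cls_AE[OF f])
  have "AE x in \<mu>. rep (shifted \<mu> (F, K)) x = rep U x"
    using rep_shifted_mult_op_AE[OF M FK] F
    by eventually_elim (simp add: real_plus_i_nonzero mult.assoc[symmetric])
  moreover have "shifted \<mu> (F, K) \<in> L2 \<mu>"
    using FK mult_op_subset_L2 by (auto intro: shifted_in_L2)
  ultimately have "shifted \<mu> (F, K) = U"
    using U by (intro L2_eqI)
  with FK F show thesis using that by blast
qed

text \<open>
  Since \<open>|x + \<i>|\<^sup>2 = x\<^sup>2 + 1\<close>, applying \<open>M + \<i>\<close> dominates both the distance of the arguments and that of
  the values of \<open>M\<close>. Convergence in the range of \<open>M + \<i>\<close> is therefore convergence in the graph of
  \<open>M\<close>, and \<open>M + \<i>\<close> is injective.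
\<close>

lemma shifted_mult_op_expanding:
  assumes M: "sets \<mu> = sets borel" and "(F, K) \<in> mult_op \<mu>" "(F', K') \<in> mult_op \<mu>"
  shows "l2_dist \<mu> F F' \<le> l2_dist \<mu> (shifted \<mu> (F, K)) (shifted \<mu> (F', K'))"
    and "l2_dist \<mu> K K' \<le> l2_dist \<mu> (shifted \<mu> (F, K)) (shifted \<mu> (F', K'))"
proof -
  let ?U = "shifted \<mu> (F, K)" and ?U' = "shifted \<mu> (F', K')"
  let ?u = "\<lambda>x. rep ?U x - rep ?U' x"
  have L: "F \<in> L2 \<mu>" "K \<in> L2 \<mu>" "F' \<in> L2 \<mu>" "K' \<in> L2 \<mu>"
    using assms mult_op_subset_L2 by auto
  then have U: "?U \<in> L2 \<mu>" "?U' \<in> L2 \<mu>" by (simp_all add: shifted_in_L2)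
  have u: "?u \<in> sq_integrable \<mu>" using U by (rule rep_diff_sq_integrable)
  have f: "(\<lambda>x. inverse (of_real x + \<i>) * ?u x) \<in> sq_integrable \<mu>"
    and k: "(\<lambda>x. of_real x * inverse (of_real x + \<i>) * ?u x) \<in> sq_integrable \<mu>"
    using sq_integrable_resolvent[OF M u] by simp_all
  have K: "AE x in \<mu>. rep K x = of_real x * rep F x" "AE x in \<mu>. rep K' x = of_real x * rep F' x"
    using assms by (simp_all add: mult_op_iff)
  have inv: "inverse (of_real x + \<i>) * ((of_real x + \<i>) * a - (of_real x + \<i>) * b) = a - b" for x a b
    unfolding right_diff_distrib[symmetric] mult.assoc[symmetric]
    by (simp add: real_plus_i_nonzero)
  have F_AE: "AE x in \<mu>. rep F x - rep F' x = inverse (of_real x + \<i>) * ?u x"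
    using rep_shifted_mult_op_AE[OF M assms(2)] rep_shifted_mult_op_AE[OF M assms(3)]
    by eventually_elim (simp add: inv)
  have "l2_dist \<mu> F F' = nrm \<mu> (\<lambda>x. inverse (of_real x + \<i>) * ?u x)"
    using F_AE by (intro l2_dist_cong_AE L f)
  also have "\<dots> \<le> nrm \<mu> ?u"
    using resolvent_bounds(1) by (intro nrm_mono f u) (simp add: norm_mult mult_left_le_one_le)
  finally show "l2_dist \<mu> F F' \<le> l2_dist \<mu> ?U ?U'" by (simp add: l2_dist_eq_nrm)
  have K_AE: "AE x in \<mu>. rep K x - rep K' x = of_real x * inverse (of_real x + \<i>) * ?u x"
    using K F_AE by eventually_elim (simp add: mult.assoc right_diff_distrib[symmetric])
  have "l2_dist \<mu> K K' = nrm \<mu> (\<lambda>x. of_real x * inverse (of_real x + \<i>) * ?u x)"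
    using K_AE by (intro l2_dist_cong_AE L k)
  also have "\<dots> \<le> nrm \<mu> ?u"
    by (intro nrm_mono k u)
       (unfold norm_mult[of "of_real _ * inverse _"], intro mult_left_le_one_le resolvent_bounds norm_ge_zero)
  finally show "l2_dist \<mu> K K' \<le> l2_dist \<mu> ?U ?U'" by (simp add: l2_dist_eq_nrm)
qed

lemma linear_operator_mult_op:
  assumes M: "sets \<mu> = sets borel"
  shows "linear_operator \<mu> (mult_op \<mu>)"
  unfolding linear_operator_def
proof (intro conjI)
  show "mult_op \<mu> \<subseteq> L2 \<mu> \<times> L2 \<mu>" by (rule mult_op_subset_L2)
  show "single_valued (mult_op \<mu>)"
  proof (rule single_valuedI)
    fix F K K' assume "(F, K) \<in> mult_op \<mu>" "(F, K') \<in> mult_op \<mu>"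
    then have L: "K \<in> L2 \<mu>" "K' \<in> L2 \<mu>" and
      AE: "AE x in \<mu>. rep K x = of_real x * rep F x" "AE x in \<mu>. rep K' x = of_real x * rep F x"
      by (simp_all add: mult_op_iff[OF M])
    from AE have "AE x in \<mu>. rep K x = rep K' x" by eventually_elim simp
    then show "K = K'" by (rule L2_eqI[OF L])
  qed
  have "AE x in \<mu>. rep (l2_zero \<mu>) x = of_real x * rep (l2_zero \<mu>) x"
    using rep_zero_AE by eventually_elim simp
  then show "(l2_zero \<mu>, l2_zero \<mu>) \<in> mult_op \<mu>"
    by (simp add: mult_op_iff[OF M] L2_intros)
  have "(l2_add \<mu> F F', l2_add \<mu> K K') \<in> mult_op \<mu>"
    if FK: "(F, K) \<in> mult_op \<mu>" "(F', K') \<in> mult_op \<mu>" for F K F' K'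
  proof -
    have L: "F \<in> L2 \<mu>" "F' \<in> L2 \<mu>" "K \<in> L2 \<mu>" "K' \<in> L2 \<mu>" and
      AE: "AE x in \<mu>. rep K x = of_real x * rep F x" "AE x in \<mu>. rep K' x = of_real x * rep F' x"
      using FK by (simp_all add: mult_op_iff[OF M])
    have "AE x in \<mu>. rep (l2_add \<mu> K K') x = of_real x * rep (l2_add \<mu> F F') x"
      using AE rep_add_AE[OF L(1,2)] rep_add_AE[OF L(3,4)]
      by eventually_elim (simp add: distrib_left)
    then show ?thesis using L by (simp add: mult_op_iff[OF M] L2_intros)
  qed
  then show "\<forall>(F, K)\<in>mult_op \<mu>. \<forall>(F', K')\<in>mult_op \<mu>. (l2_add \<mu> F F', l2_add \<mu> K K') \<in> mult_op \<mu>"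
    by blast
  have "(l2_scale \<mu> c F, l2_scale \<mu> c K) \<in> mult_op \<mu>" if FK: "(F, K) \<in> mult_op \<mu>" for F K c
  proof -
    have L: "F \<in> L2 \<mu>" "K \<in> L2 \<mu>" and AE: "AE x in \<mu>. rep K x = of_real x * rep F x"
      using FK by (simp_all add: mult_op_iff[OF M])
    have "AE x in \<mu>. rep (l2_scale \<mu> c K) x = of_real x * rep (l2_scale \<mu> c F) x"
      using AE rep_scale_AE[OF L(1), of c] rep_scale_AE[OF L(2), of c]
      by eventually_elim simp
    then show ?thesis using L by (simp add: mult_op_iff[OF M] L2_intros)
  qed
  then show "\<forall>c. \<forall>(F, K)\<in>mult_op \<mu>. (l2_scale \<mu> c F, l2_scale \<mu> c K) \<in> mult_op \<mu>"
    by blast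
qed

lemma mult_op_symmetric:
  assumes M: "sets \<mu> = sets borel"
  shows "mult_op \<mu> \<subseteq> adjoint_op \<mu> (mult_op \<mu>)"
proof -
  have "l2_inner \<mu> G K = l2_inner \<mu> H F"
    if "(G, H) \<in> mult_op \<mu>" "(F, K) \<in> mult_op \<mu>" for F G H K
  proof -
    have L: "F \<in> L2 \<mu>" "K \<in> L2 \<mu>" "G \<in> L2 \<mu>" "H \<in> L2 \<mu>" and
      AE: "AE x in \<mu>. rep K x = of_real x * rep F x" "AE x in \<mu>. rep H x = of_real x * rep G x"
      using that by (simp_all add: mult_op_iff[OF M])
    have [measurable]: "rep F \<in> borel_measurable \<mu>" "rep K \<in> borel_measurable \<mu>"
      "rep G \<in> borel_measurable \<mu>" "rep H \<in> borel_measurable \<mu>"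
      using L by (simp_all add: rep_measurable)
    have "AE x in \<mu>. cnj (rep G x) * rep K x = cnj (rep H x) * rep F x"
      using AE by eventually_elim simp
    then show ?thesis
      unfolding l2_inner_def by (intro integral_cong_AE) measurable
  qed
  then show ?thesis
    using mult_op_subset_L2 unfolding adjoint_op_def by blast
qed

section \<open>The restriction determined by a subspace\<close>

text \<open>
  The integral condition that defines the domain is \<open>\<langle>G, (M + \<i>)F\<rangle> = 0\<close>, so the restriction consists
  of the part of \<open>M\<close> that \<open>M + \<i>\<close> maps into the orthogonal complement of \<open>V\<close>.
\<close>

lemma restr_op_eq:
  assumes M: "sets \<mu> = sets borel" and V: "V \<subseteq> L2 \<mu>"
  shows "restr_op \<mu> V = {P \<in> mult_op \<mu>. shifted \<mu> P \<in> orth \<mu> V}"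
proof -
  have "(LINT x|\<mu>. cnj (rep G x) * (of_real x + \<i>) * rep F x) = l2_inner \<mu> G (shifted \<mu> (F, K))"
    if FK: "(F, K) \<in> mult_op \<mu>" and G: "G \<in> V" for F G K
  proof -
    have L: "F \<in> L2 \<mu>" "K \<in> L2 \<mu>" "G \<in> L2 \<mu>"
      using FK G V mult_op_subset_L2 by auto
    have [measurable]: "rep F \<in> borel_measurable \<mu>" "rep G \<in> borel_measurable \<mu>"
      "rep (shifted \<mu> (F, K)) \<in> borel_measurable \<mu>" "(\<lambda>x. complex_of_real x) \<in> borel_measurable \<mu>"
      using L measurable_of_real_borel[OF M] by (auto simp: rep_measurable shifted_in_L2)
    have "AE x in \<mu>. cnj (rep G x) * (of_real x + \<i>) * rep F x
        = cnj (rep G x) * rep (shifted \<mu> (F, K)) x"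
      using rep_shifted_mult_op_AE[OF M FK] by eventually_elim (simp only: mult.assoc)
    then show ?thesis
      unfolding l2_inner_def by (intro integral_cong_AE) measurable
  qed
  moreover have "shifted \<mu> (F, K) \<in> L2 \<mu>" if "(F, K) \<in> mult_op \<mu>" for F K
    using that mult_op_subset_L2 by (auto intro: shifted_in_L2)
  ultimately show ?thesis
    unfolding restr_op_def orth_def by auto
qed

text \<open>
  Surjectivity of \<open>M + \<i>\<close> makes the range of the shifted restriction the whole complement, not just a
  part of it.
\<close>

lemma shifted_restr_op:
  assumes M: "sets \<mu> = sets borel" and V: "V \<subseteq> L2 \<mu>"
  shows "shifted \<mu> ` restr_op \<mu> V = orth \<mu> V"
proof
  show "shifted \<mu> ` restr_op \<mu> V \<subseteq> orth \<mu> V"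
    unfolding restr_op_eq[OF assms] by blast
  show "orth \<mu> V \<subseteq> shifted \<mu> ` restr_op \<mu> V"
  proof
    fix U assume U: "U \<in> orth \<mu> V"
    then have "U \<in> L2 \<mu>" using orth_subset_L2 by blast
    from shifted_mult_op_surj[OF M this] obtain F K
      where "(F, K) \<in> mult_op \<mu>" "shifted \<mu> (F, K) = U" .
    then show "U \<in> shifted \<mu> ` restr_op \<mu> V"
      unfolding restr_op_eq[OF assms] using U by (intro image_eqI[of _ _ "(F, K)"]) auto
  qed
qed

text \<open>
  The deficiency space is the complement of the range, which is itself the complement of \<open>V\<close>; the
  bipolar theorem brings back \<open>V\<close> when it is closed.
\<close>

lemma DEF_plus_restr_op:
  assumes "prob_space \<mu>" "sets \<mu> = sets borel" and V: "l2_subspace \<mu> V" "closedin (l2_topology \<mu>) V"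
  shows "DEF_plus \<mu> (restr_op \<mu> V) = V"
proof -
  have VL: "V \<subseteq> L2 \<mu>" using V by (simp add: l2_subspace_def)
  have "restr_op \<mu> V \<subseteq> L2 \<mu> \<times> L2 \<mu>"
    using mult_op_subset_L2 by (auto simp: restr_op_def)
  then have "DEF_plus \<mu> (restr_op \<mu> V) = orth \<mu> (orth \<mu> V)"
    by (simp add: DEF_plus_eq_orth shifted_restr_op assms VL)
  also have "\<dots> = V"
    using V by (simp add: orth_orth_eq_closure assms closure_of_closedin)
  finally show ?thesis .
qed

lemma linear_operator_restr_op:
  assumes M: "sets \<mu> = sets borel" and V: "V \<subseteq> L2 \<mu>"
  shows "linear_operator \<mu> (restr_op \<mu> V)"
proof -
  note mult = linear_operator_mult_op[OF M, unfolded linear_operator_def]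
  note orth = l2_subspace_orth[OF V, unfolded l2_subspace_def]
  show ?thesis
    unfolding linear_operator_def restr_op_eq[OF M V]
  proof (intro conjI)
    show "{P \<in> mult_op \<mu>. shifted \<mu> P \<in> orth \<mu> V} \<subseteq> L2 \<mu> \<times> L2 \<mu>"
      using mult by blast
    show "single_valued {P \<in> mult_op \<mu>. shifted \<mu> P \<in> orth \<mu> V}"
      using mult by (auto intro: single_valued_subset)
    show "(l2_zero \<mu>, l2_zero \<mu>) \<in> {P \<in> mult_op \<mu>. shifted \<mu> P \<in> orth \<mu> V}"
      using mult orth by (simp add: shifted_zero)
    have "(l2_add \<mu> F F', l2_add \<mu> K K') \<in> {P \<in> mult_op \<mu>. shifted \<mu> P \<in> orth \<mu> V}"
      if FK: "(F, K) \<in> mult_op \<mu>" "shifted \<mu> (F, K) \<in> orth \<mu> V"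
        "(F', K') \<in> mult_op \<mu>" "shifted \<mu> (F', K') \<in> orth \<mu> V" for F K F' K'
    proof -
      have L: "F \<in> L2 \<mu>" "K \<in> L2 \<mu>" "F' \<in> L2 \<mu>" "K' \<in> L2 \<mu>"
        using FK mult_op_subset_L2 by auto
      have "(l2_add \<mu> F F', l2_add \<mu> K K') \<in> mult_op \<mu>"
        using mult FK by blast
      then show ?thesis
        using orth FK by (simp add: shifted_add[OF L, symmetric])
    qed
    then show "\<forall>(F, K)\<in>{P \<in> mult_op \<mu>. shifted \<mu> P \<in> orth \<mu> V}.
        \<forall>(F', K')\<in>{P \<in> mult_op \<mu>. shifted \<mu> P \<in> orth \<mu> V}.
          (l2_add \<mu> F F', l2_add \<mu> K K') \<in> {P \<in> mult_op \<mu>. shifted \<mu> P \<in> orth \<mu> V}"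
      by blast
    have "(l2_scale \<mu> c F, l2_scale \<mu> c K) \<in> {P \<in> mult_op \<mu>. shifted \<mu> P \<in> orth \<mu> V}"
      if FK: "(F, K) \<in> mult_op \<mu>" "shifted \<mu> (F, K) \<in> orth \<mu> V" for F K c
    proof -
      have L: "F \<in> L2 \<mu>" "K \<in> L2 \<mu>"
        using FK mult_op_subset_L2 by auto
      have "(l2_scale \<mu> c F, l2_scale \<mu> c K) \<in> mult_op \<mu>"
        using mult FK by blast
      then show ?thesis
        using orth FK by (simp add: shifted_scale[OF L, symmetric])
    qed
    then show "\<forall>c. \<forall>(F, K)\<in>{P \<in> mult_op \<mu>. shifted \<mu> P \<in> orth \<mu> V}.
          (l2_scale \<mu> c F, l2_scale \<mu> c K) \<in> {P \<in> mult_op \<mu>. shifted \<mu> P \<in> orth \<mu> V}"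
      by blast
  qed
qed

text \<open>
  A limit point \<open>(F, K)\<close> of the graph has \<open>K + \<i>F\<close> in the closed space \<open>V\<^sup>\<bottom>\<close>. Solving
  \<open>(M + \<i>)F\<^sub>0 = K + \<i>F\<close> gives a pair of the graph, and the expanding property shows that this pair is
  \<open>(F, K)\<close>.
\<close>

lemma closedin_restr_op:
  assumes M: "sets \<mu> = sets borel" and V: "V \<subseteq> L2 \<mu>"
  shows "closedin (graph_topology \<mu>) (restr_op \<mu> V)"
proof -
  interpret Metric_space "L2 \<mu>" "l2_dist \<mu>" by (rule Metric_space_L2)
  have sub: "restr_op \<mu> V \<subseteq> mult_op \<mu>" by (auto simp: restr_op_def)
  then have subL: "restr_op \<mu> V \<subseteq> L2 \<mu> \<times> L2 \<mu>" using mult_op_subset_L2 by blast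
  have "(F, K) \<in> restr_op \<mu> V" if "(F, K) \<in> graph_topology \<mu> closure_of restr_op \<mu> V" for F K
  proof -
    have L: "F \<in> L2 \<mu>" "K \<in> L2 \<mu>" and near: "\<And>e. e > 0 \<Longrightarrow>
        \<exists>(F', K')\<in>restr_op \<mu> V. l2_dist \<mu> F F' < e \<and> l2_dist \<mu> K K' < e"
      using that by (auto simp: in_graph_closure_iff[OF subL])
    define U where "U = shifted \<mu> (F, K)"
    have U: "U \<in> L2 \<mu>" using L by (simp add: U_def shifted_in_L2)
    obtain F0 K0 where 0: "(F0, K0) \<in> mult_op \<mu>" "shifted \<mu> (F0, K0) = U"
      using shifted_mult_op_surj[OF M U] .
    have L0: "F0 \<in> L2 \<mu>" "K0 \<in> L2 \<mu>" using 0 mult_op_subset_L2 by auto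
    have approx: "\<exists>U'\<in>orth \<mu> V. l2_dist \<mu> U U' < e \<and> l2_dist \<mu> F F0 < e \<and> l2_dist \<mu> K K0 < e"
      if e: "e > 0" for e
    proof -
      obtain F' K' where FK': "(F', K') \<in> restr_op \<mu> V"
        and d: "l2_dist \<mu> F F' < e / 3" "l2_dist \<mu> K K' < e / 3"
        using near[of "e / 3"] e by auto
      have M': "(F', K') \<in> mult_op \<mu>" using FK' sub by blast
      then have L': "F' \<in> L2 \<mu>" "K' \<in> L2 \<mu>" using mult_op_subset_L2 by auto
      let ?U' = "shifted \<mu> (F', K')"
      have U': "?U' \<in> orth \<mu> V" using FK' by (simp add: restr_op_eq[OF M V])
      have dU: "l2_dist \<mu> U ?U' \<le> l2_dist \<mu> K K' + l2_dist \<mu> F F'"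
      proof -
        let ?d = "\<lambda>x. (rep K x - rep K' x) + \<i> * (rep F x - rep F' x)"
        have d: "?d \<in> sq_integrable \<mu>"
          by (intro sq_integrable_add sq_integrable_scale rep_diff_sq_integrable L L')
        have "AE x in \<mu>. rep U x - rep ?U' x = ?d x"
          unfolding U_def using rep_shifted_AE[OF L] rep_shifted_AE[OF L']
          by eventually_elim (simp add: right_diff_distrib)
        then have "l2_dist \<mu> U ?U' = nrm \<mu> ?d"
          using U d by (intro l2_dist_cong_AE shifted_in_L2 L')
        also have "\<dots> \<le> nrm \<mu> (\<lambda>x. rep K x - rep K' x) + nrm \<mu> (\<lambda>x. \<i> * (rep F x - rep F' x))"
          by (intro nrm_triangle sq_integrable_scale rep_diff_sq_integrable L L')
        finally show ?thesis by (simp add: l2_dist_eq_nrm nrm_scale)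
      qed
      \<comment> \<open>Two of the three parts of \<open>e\<close> go into \<open>dU\<close>, the third into the distance from \<open>F\<close> to \<open>F'\<close>,
        respectively from \<open>K\<close> to \<open>K'\<close>.\<close>
      have "l2_dist \<mu> F' F0 \<le> l2_dist \<mu> ?U' U" "l2_dist \<mu> K' K0 \<le> l2_dist \<mu> ?U' U"
        using shifted_mult_op_expanding[OF M M' 0(1)] 0(2) by simp_all
      then have "l2_dist \<mu> F F0 < e" "l2_dist \<mu> K K0 < e"
        using triangle[OF L(1) L'(1) L0(1)] triangle[OF L(2) L'(2) L0(2)] dU d
          commute[of U ?U'] by linarith+
      moreover have "l2_dist \<mu> U ?U' < e" using dU d e by linarith
      ultimately show ?thesis using U' by blast
    qed
    have "l2_dist \<mu> F F0 \<le> 0" "l2_dist \<mu> K K0 \<le> 0"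
      by (rule field_le_epsilon, use approx in fastforce)+
    then have eq: "F = F0" "K = K0"
      using L L0 nonneg[of F F0] nonneg[of K K0] by (auto simp: order_antisym)
    have "U \<in> l2_topology \<mu> closure_of orth \<mu> V"
      using U approx by (auto simp: in_l2_closure_iff orth_subset_L2)
    then have "U \<in> orth \<mu> V"
      using closedin_orth[OF V] by (simp add: closure_of_closedin)
    then show ?thesis
      using 0 by (simp add: eq restr_op_eq[OF M V])
  qed
  then have "graph_topology \<mu> closure_of restr_op \<mu> V \<subseteq> restr_op \<mu> V" by auto
  moreover have "restr_op \<mu> V \<subseteq> topspace (graph_topology \<mu>)"
    using subL by (simp add: graph_topology_def topspace_l2_topology)
  ultimately show ?thesis
    using closure_of_subset_eq by blast
qed

section \<open>Dense domains and the growth condition\<close>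

lemma densely_defined_iff:
  assumes P: "prob_space \<mu>" and T: "linear_operator \<mu> T"
  shows "densely_defined \<mu> T \<longleftrightarrow> orth \<mu> (Domain T) = {l2_zero \<mu>}"
proof -
  have D: "l2_subspace \<mu> (Domain T)" using T by (rule linear_operator_Domain)
  then have DL: "Domain T \<subseteq> L2 \<mu>" by (simp add: l2_subspace_def)
  have cl: "l2_topology \<mu> closure_of Domain T = orth \<mu> (orth \<mu> (Domain T))"
    using orth_orth_eq_closure[OF P D] by simp
  have zero: "l2_zero \<mu> \<in> orth \<mu> (Domain T)"
    using l2_subspace_orth[OF DL] by (simp add: l2_subspace_def)
  show ?thesis
  proof
    assume "densely_defined \<mu> T"
    then have "orth \<mu> (orth \<mu> (Domain T)) = L2 \<mu>"
      using cl by (simp add: densely_defined_def)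
    then have "G = l2_zero \<mu>" if "G \<in> orth \<mu> (Domain T)" for G
      using that by (intro l2_inner_self_eq_0) (auto simp: orth_def)
    then show "orth \<mu> (Domain T) = {l2_zero \<mu>}" using zero by blast
  next
    assume *: "orth \<mu> (Domain T) = {l2_zero \<mu>}"
    have "orth \<mu> {l2_zero \<mu>} = L2 \<mu>"
      by (auto simp: orth_def l2_inner_eq_0_commute[of _ "l2_zero \<mu>"] l2_inner_zero_right)
    then show "densely_defined \<mu> T"
      unfolding densely_defined_def cl * .
  qed
qed

text \<open>
  A vector \<open>H\<close> orthogonal to the domain satisfies \<open>\<langle>U, H / (x - \<i>)\<rangle> = \<langle>U / (x + \<i>), H\<rangle> = 0\<close> for every
  \<open>U\<close> orthogonal to \<open>V\<close>. So \<open>G = H / (x - \<i>)\<close> lies in \<open>V\<^sup>\<bottom>\<^sup>\<bottom> = V\<close>, while \<open>x G\<close> is square integrable; the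
  condition on \<open>V\<close> leaves only \<open>G = 0\<close>.
\<close>

lemma densely_defined_restr_op:
  assumes P: "prob_space \<mu>" and M: "sets \<mu> = sets borel"
    and V: "l2_subspace \<mu> V" "closedin (l2_topology \<mu>) V"
    and adm: "\<And>G. G \<in> V \<Longrightarrow> G \<noteq> l2_zero \<mu> \<Longrightarrow> (\<lambda>x. of_real x * rep G x) \<notin> sq_integrable \<mu>"
  shows "densely_defined \<mu> (restr_op \<mu> V)"
proof -
  have VL: "V \<subseteq> L2 \<mu>" using V by (simp add: l2_subspace_def)
  note T = linear_operator_restr_op[OF M VL]
  have "H = l2_zero \<mu>" if H: "H \<in> orth \<mu> (Domain (restr_op \<mu> V))" for H
  proof -
    have HL: "H \<in> L2 \<mu>" using H by (simp add: orth_def)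
    define g where "g x = inverse (complex_of_real x - \<i>) * rep H x" for x
    have cnj: "complex_of_real x - \<i> = cnj (complex_of_real x + \<i>)" for x by simp
    have [measurable]: "(\<lambda>x. complex_of_real x) \<in> borel_measurable \<mu>" "rep H \<in> borel_measurable \<mu>"
      using measurable_of_real_borel[OF M] HL by (auto simp: rep_measurable)
    \<comment> \<open>The bounds for \<open>1 / (x + \<i>)\<close> carry over because conjugation preserves the modulus.\<close>
    have bounds: "cmod (inverse (complex_of_real x - \<i>)) \<le> 1"
      "cmod (complex_of_real x * inverse (complex_of_real x - \<i>)) \<le> 1" for x
      using resolvent_bounds[of x]
      by (simp_all only: cnj complex_cnj_inverse[symmetric] norm_mult complex_mod_cnj)
    have g: "g \<in> sq_integrable \<mu>"
      unfolding g_def[abs_def]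
      by (rule sq_integrable_bounded_mult[OF rep_sq_integrable[OF HL] _ bounds(1)]) measurable
    have xg: "(\<lambda>x. of_real x * g x) \<in> sq_integrable \<mu>"
      unfolding g_def[abs_def] mult.assoc[symmetric]
      by (rule sq_integrable_bounded_mult[OF rep_sq_integrable[OF HL] _ bounds(2)]) measurable
    define G where "G = cls \<mu> g"
    have GL: "G \<in> L2 \<mu>" using g by (simp add: G_def cls_in_L2)
    have G: "AE x in \<mu>. rep G x = g x" unfolding G_def by (rule rep_cls_AE[OF g])
    have "l2_inner \<mu> U G = 0" if U: "U \<in> orth \<mu> V" for U
    proof -
      have UL: "U \<in> L2 \<mu>" using U orth_subset_L2 by blast
      obtain F K where FK: "(F, K) \<in> mult_op \<mu>" "shifted \<mu> (F, K) = U"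
        and F: "AE x in \<mu>. rep F x = inverse (of_real x + \<i>) * rep U x"
        using shifted_mult_op_surj[OF M UL] .
      then have "(F, K) \<in> restr_op \<mu> V"
        using U by (simp add: restr_op_eq[OF M VL])
      then have "l2_inner \<mu> F H = 0" using H by (auto simp: orth_def)
      moreover have "l2_inner \<mu> U G = l2_inner \<mu> F H"
      proof -
        have [measurable]: "rep U \<in> borel_measurable \<mu>" "rep G \<in> borel_measurable \<mu>"
          "rep F \<in> borel_measurable \<mu>"
          using UL GL FK(1) by (simp_all add: rep_measurable mult_op_iff[OF M])
        have "AE x in \<mu>. cnj (rep U x) * rep G x = cnj (rep F x) * rep H x"
          using F G by eventually_elim (simp add: g_def)
        then show ?thesis
          unfolding l2_inner_def by (intro integral_cong_AE) measurable
      qed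
      ultimately show ?thesis by simp
    qed
    then have "G \<in> orth \<mu> (orth \<mu> V)" using GL by (simp add: orth_def)
    then have GV: "G \<in> V"
      using V by (simp add: orth_orth_eq_closure[OF P] closure_of_closedin)
    have "(\<lambda>x. of_real x * rep G x) \<in> sq_integrable \<mu>"
    proof (rule sq_integrable_cong_AE[OF xg])
      have [measurable]: "rep G \<in> borel_measurable \<mu>" using GL by (rule rep_measurable)
      show "(\<lambda>x. of_real x * rep G x) \<in> borel_measurable \<mu>" by measurable
      show "AE x in \<mu>. of_real x * g x = of_real x * rep G x"
        using G by eventually_elim simp
    qed
    then have "G = l2_zero \<mu>" using adm GV by blast
    then have "AE x in \<mu>. g x = 0"
      using G rep_zero_AE[of \<mu>] by (auto elim: eventually_elim2)
    then have "AE x in \<mu>. rep H x = rep (l2_zero \<mu>) x"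
      using rep_zero_AE[of \<mu>] by eventually_elim (simp add: g_def real_plus_i_nonzero)
    then show ?thesis
      by (rule L2_eqI[OF HL l2_zero_in_L2])
  qed
  moreover have "l2_zero \<mu> \<in> orth \<mu> (Domain (restr_op \<mu> V))"
    using linear_operator_Domain[OF T] l2_subspace_orth[of "Domain (restr_op \<mu> V)" \<mu>]
    by (simp add: l2_subspace_def)
  ultimately show ?thesis
    unfolding densely_defined_iff[OF P T] by blast
qed

lemma hermitian_restriction_restr_op:
  assumes P: "prob_space \<mu>" and M: "sets \<mu> = sets borel" and V: "V \<in> admissible_subspaces \<mu>"
  shows "hermitian_restriction \<mu> (restr_op \<mu> V)"
proof -
  have sub: "l2_subspace \<mu> V" "closedin (l2_topology \<mu>) V"
    and adm: "\<And>G. G \<in> V \<Longrightarrow> G \<noteq> l2_zero \<mu> \<Longrightarrow> (\<lambda>x. of_real x * rep G x) \<notin> sq_integrable \<mu>"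
    using V by (auto simp: admissible_subspaces_def)
  have VL: "V \<subseteq> L2 \<mu>" using sub by (simp add: l2_subspace_def)
  have M': "restr_op \<mu> V \<subseteq> mult_op \<mu>" by (auto simp: restr_op_def)
  have "restr_op \<mu> V \<subseteq> adjoint_op \<mu> (restr_op \<mu> V)"
    using M' mult_op_symmetric[OF M] unfolding adjoint_op_def by blast
  then show ?thesis
    unfolding hermitian_restriction_def hermitian_operator_def
    using linear_operator_restr_op[OF M VL] densely_defined_restr_op[OF P M sub adm] M' by blast
qed

text \<open>
  The converse of the density argument: if \<open>G\<close> is in the deficiency space and \<open>x G\<close> is square
  integrable, then \<open>(x - \<i>) G\<close> is orthogonal to the dense domain of \<open>S\<close> and hence vanishes.
\<close>

lemma DEF_plus_admissible:
  assumes P: "prob_space \<mu>" and M: "sets \<mu> = sets borel"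
    and S: "hermitian_restriction \<mu> S" and fin: "finite_dimensional \<mu> (DEF_plus \<mu> S)"
  shows "DEF_plus \<mu> S \<in> admissible_subspaces \<mu>"
proof -
  have lin: "linear_operator \<mu> S" and dense: "densely_defined \<mu> S" and SM: "S \<subseteq> mult_op \<mu>"
    using S by (auto simp: hermitian_restriction_def hermitian_operator_def)
  have SL: "S \<subseteq> L2 \<mu> \<times> L2 \<mu>" using lin by (simp add: linear_operator_def)
  have RL: "shifted \<mu> ` S \<subseteq> L2 \<mu>"
    using linear_operator_shifted_range[OF lin] by (simp add: l2_subspace_def)
  note def_eq = DEF_plus_eq_orth[OF SL]
  have "G = l2_zero \<mu>"
    if G: "G \<in> DEF_plus \<mu> S" and xG: "(\<lambda>x. of_real x * rep G x) \<in> sq_integrable \<mu>" for G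
  proof -
    have GL: "G \<in> L2 \<mu>" using G by (simp add: def_eq orth_def)
    then have g: "rep G \<in> sq_integrable \<mu>" by (rule rep_sq_integrable)
    let ?h = "\<lambda>x. of_real x * rep G x - \<i> * rep G x"
    have h: "?h \<in> sq_integrable \<mu>" by (intro sq_integrable_diff sq_integrable_scale g xG)
    have "l2_inner \<mu> F (cls \<mu> ?h) = 0" if F: "F \<in> Domain S" for F
    proof -
      obtain K where FK: "(F, K) \<in> S" using F by blast
      then have FKM: "(F, K) \<in> mult_op \<mu>" and L: "F \<in> L2 \<mu>" "K \<in> L2 \<mu>" using SM SL by auto
      have [measurable]: "rep F \<in> borel_measurable \<mu>" "rep G \<in> borel_measurable \<mu>"
        "rep (shifted \<mu> (F, K)) \<in> borel_measurable \<mu>" "?h \<in> borel_measurable \<mu>"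
        using L GL h by (auto simp: rep_measurable shifted_in_L2 sq_integrable_measurable)
      have "AE x in \<mu>. cnj (rep F x) * ?h x = cnj (rep (shifted \<mu> (F, K)) x) * rep G x"
        using rep_shifted_mult_op_AE[OF M FKM] by eventually_elim (simp add: algebra_simps)
      then have "ip \<mu> (rep F) ?h = l2_inner \<mu> (shifted \<mu> (F, K)) G"
        unfolding l2_inner_def ip_def by (intro integral_cong_AE) measurable
      also have "\<dots> = 0" using G FK by (auto simp: def_eq orth_def)
      finally show ?thesis using L h by (simp add: l2_inner_cls_right)
    qed
    then have "cls \<mu> ?h \<in> orth \<mu> (Domain S)"
      using h by (simp add: orth_def cls_in_L2)
    then have "cls \<mu> ?h = l2_zero \<mu>"
      using dense by (simp add: densely_defined_iff[OF P lin])
    then have "AE x in \<mu>. ?h x = 0"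
      unfolding l2_zero_def using cls_eq_iff[OF h sq_integrable_zero] by simp
    then have "AE x in \<mu>. rep G x = rep (l2_zero \<mu>) x"
      using rep_zero_AE[of \<mu>]
      by eventually_elim (simp add: left_diff_distrib[symmetric] real_plus_i_nonzero)
    then show ?thesis by (rule L2_eqI[OF GL l2_zero_in_L2])
  qed
  then show ?thesis
    unfolding admissible_subspaces_def
    using fin l2_subspace_orth[OF RL] closedin_orth[OF RL] by (auto simp: def_eq)
qed

text \<open>
  By the bipolar theorem the restriction determined by \<open>DEF_plus \<mu> S\<close> is the part of \<open>M\<close> that
  \<open>M + \<i>\<close> maps into the closure of the range of \<open>S + \<i>\<close>. The expanding property carries approximation
  in that range back to approximation in the graph.
\<close>

lemma closure_hermitian_restriction:
  assumes P: "prob_space \<mu>" and M: "sets \<mu> = sets borel" and S: "hermitian_restriction \<mu> S"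
  shows "graph_topology \<mu> closure_of S = restr_op \<mu> (DEF_plus \<mu> S)"
proof
  have lin: "linear_operator \<mu> S" and SM: "S \<subseteq> mult_op \<mu>"
    using S by (auto simp: hermitian_restriction_def hermitian_operator_def)
  have SL: "S \<subseteq> L2 \<mu> \<times> L2 \<mu>" using lin by (simp add: linear_operator_def)
  have R: "l2_subspace \<mu> (shifted \<mu> ` S)" using lin by (rule linear_operator_shifted_range)
  then have RL: "shifted \<mu> ` S \<subseteq> L2 \<mu>" by (simp add: l2_subspace_def)
  have VL: "DEF_plus \<mu> S \<subseteq> L2 \<mu>"
    unfolding DEF_plus_eq_orth[OF SL] by (rule orth_subset_L2)
  have restr: "restr_op \<mu> (DEF_plus \<mu> S)
      = {Q \<in> mult_op \<mu>. shifted \<mu> Q \<in> l2_topology \<mu> closure_of (shifted \<mu> ` S)}"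
    unfolding restr_op_eq[OF M VL] unfolding DEF_plus_eq_orth[OF SL] orth_orth_eq_closure[OF P R] ..
  show "graph_topology \<mu> closure_of S \<subseteq> restr_op \<mu> (DEF_plus \<mu> S)"
  proof (rule closure_of_minimal)
    show "closedin (graph_topology \<mu>) (restr_op \<mu> (DEF_plus \<mu> S))"
      by (rule closedin_restr_op[OF M VL])
    have "shifted \<mu> ` S \<subseteq> l2_topology \<mu> closure_of (shifted \<mu> ` S)"
      using RL by (intro closure_of_subset) (simp add: topspace_l2_topology)
    then show "S \<subseteq> restr_op \<mu> (DEF_plus \<mu> S)"
      unfolding restr using SM by blast
  qed
  show "restr_op \<mu> (DEF_plus \<mu> S) \<subseteq> graph_topology \<mu> closure_of S"
  proof (rule subrelI)
    fix F K assume "(F, K) \<in> restr_op \<mu> (DEF_plus \<mu> S)"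
    then have FK: "(F, K) \<in> mult_op \<mu>"
      and cl: "shifted \<mu> (F, K) \<in> l2_topology \<mu> closure_of (shifted \<mu> ` S)"
      by (auto simp: restr)
    have "\<exists>(F', K')\<in>S. l2_dist \<mu> F F' < e \<and> l2_dist \<mu> K K' < e" if "e > 0" for e
    proof -
      obtain F' K' where FK': "(F', K') \<in> S"
        and d: "l2_dist \<mu> (shifted \<mu> (F, K)) (shifted \<mu> (F', K')) < e"
        using cl \<open>e > 0\<close> by (auto simp: in_l2_closure_iff[OF RL])
      have "(F', K') \<in> mult_op \<mu>" using FK' SM by blast
      then have "l2_dist \<mu> F F' < e" "l2_dist \<mu> K K' < e"
        using shifted_mult_op_expanding[OF M FK, of F' K'] d by linarith+
      then show ?thesis using FK' by blast
    qed
    then show "(F, K) \<in> graph_topology \<mu> closure_of S"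
      using FK mult_op_subset_L2 by (auto simp: in_graph_closure_iff[OF SL])
  qed
qed

section \<open>The correspondence\<close>

theorem theorem7p3p1:
  fixes \<mu> :: "real measure"
  assumes "prob_space \<mu>" and "sets \<mu> = sets borel"
  shows "bij_betw (restr_op \<mu>) (admissible_subspaces \<mu>)
           {S. hermitian_restriction \<mu> S \<and> closed_operator \<mu> S \<and>
               (\<exists>\<L>\<in>admissible_subspaces \<mu>. DEF_plus \<mu> S = \<L>)} \<and>
         (\<forall>\<L>\<in>admissible_subspaces \<mu>. DEF_plus \<mu> (restr_op \<mu> \<L>) = \<L>) \<and>
         (\<forall>S. hermitian_restriction \<mu> S \<and> finite_dimensional \<mu> (DEF_plus \<mu> S) \<longrightarrow>
              DEF_plus \<mu> S \<in> admissible_subspaces \<mu> \<and>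
              graph_topology \<mu> closure_of S = restr_op \<mu> (DEF_plus \<mu> S))"
proof (intro conjI)
  have def_restr: "DEF_plus \<mu> (restr_op \<mu> V) = V" if "V \<in> admissible_subspaces \<mu>" for V
    using that DEF_plus_restr_op[OF assms] by (simp add: admissible_subspaces_def)
  then show "\<forall>\<L>\<in>admissible_subspaces \<mu>. DEF_plus \<mu> (restr_op \<mu> \<L>) = \<L>" by blast
  show "\<forall>S. hermitian_restriction \<mu> S \<and> finite_dimensional \<mu> (DEF_plus \<mu> S) \<longrightarrow>
              DEF_plus \<mu> S \<in> admissible_subspaces \<mu> \<and>
              graph_topology \<mu> closure_of S = restr_op \<mu> (DEF_plus \<mu> S)"
    using DEF_plus_admissible[OF assms] closure_hermitian_restriction[OF assms] by blast
  show "bij_betw (restr_op \<mu>) (admissible_subspaces \<mu>)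
           {S. hermitian_restriction \<mu> S \<and> closed_operator \<mu> S \<and>
               (\<exists>\<L>\<in>admissible_subspaces \<mu>. DEF_plus \<mu> S = \<L>)}"
  proof (rule bij_betw_byWitness[where f' = "DEF_plus \<mu>"])
    show "\<forall>V\<in>admissible_subspaces \<mu>. DEF_plus \<mu> (restr_op \<mu> V) = V"
      using def_restr by blast
    have "restr_op \<mu> (DEF_plus \<mu> S) = S"
      if "hermitian_restriction \<mu> S" "closed_operator \<mu> S" for S
      using that closure_hermitian_restriction[OF assms that(1)]
      by (simp add: closed_operator_def closure_of_closedin)
    then show "\<forall>S\<in>{S. hermitian_restriction \<mu> S \<and> closed_operator \<mu> S \<and>
        (\<exists>\<L>\<in>admissible_subspaces \<mu>. DEF_plus \<mu> S = \<L>)}. restr_op \<mu> (DEF_plus \<mu> S) = S"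
      by blast
    have "closed_operator \<mu> (restr_op \<mu> V)" if "V \<in> admissible_subspaces \<mu>" for V
      using that linear_operator_restr_op[OF assms(2)] closedin_restr_op[OF assms(2)]
      by (simp add: closed_operator_def admissible_subspaces_def l2_subspace_def)
    then show "restr_op \<mu> ` admissible_subspaces \<mu> \<subseteq> {S. hermitian_restriction \<mu> S \<and>
        closed_operator \<mu> S \<and> (\<exists>\<L>\<in>admissible_subspaces \<mu>. DEF_plus \<mu> S = \<L>)}"
      using hermitian_restriction_restr_op[OF assms] def_restr by auto
    show "DEF_plus \<mu> ` {S. hermitian_restriction \<mu> S \<and> closed_operator \<mu> S \<and>
        (\<exists>\<L>\<in>admissible_subspaces \<mu>. DEF_plus \<mu> S = \<L>)} \<subseteq> admissible_subspaces \<mu>"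
      by auto
  qed
qed

end
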